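(* Let $n\ge3$ and let $w=(w_1,\dots,w_n)$ be distributed according to the stationary distribution of the multispecies TASEP on a ring with $n$ sites of type $(1,1,\dots,1)$. For $1\le i<j<k\le n$, the probability $E_{j,k,i}=\mathbb P(w_1=j,\ w_2=k,\ w_3=i)$ is given as follows. If $k>j+1$, $$E_{j,k,i}=\frac{3(j-i)(2n-j-i-1)}{n^3(n-1)(n-2)}-\frac{4(j-i)(n-k)}{n^3(n-1)^2}.$$ If $k=j+1$, $$E_{j,k,i}=\frac{(j-i)(n-1-j)}{n^2(n-1)^2}\left(\frac1{n-2}+\frac{3(n-i-1)}{n}-\frac{(n-1-j)(3n-3i+j-1)}{n(n-2)}\right)+\frac{6(j-i)(n-i)}{n^3(n-1)(n-2)}.$$
   Context: Multispecies TASEP on a ring with $n$ sites of type $(1,\dots,1)$: the states are the permutations $w=(w_1,\dots,w_n)$ of $\{1,\dots,n\}$, with positions taken cyclically modulo $n$ ($w_i$ is the species of the particle at site $i$). It is the continuous-time Markov chain in which every particle carries an independent rate-$1$ exponential clock; when the clock of the particle of species $j$ rings, it exchanges positions with the particle of species $k$ immediately to its left if $k>j$, and nothing happens otherwise. It has a unique stationary distribution. *)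

theory Defs
  imports "HOL-Probability.Probability" "HOL-Combinatorics.Permutations"
begin

text \<open>
  Sites are \<open>1, \<dots>, n\<close>. A state is a function \<open>w\<close> with \<open>w permutes {1..n}\<close>, where \<open>w a\<close> is the
  species of the particle at site \<open>a\<close>; the value of \<open>w\<close> outside \<open>{1..n}\<close> carries no information.
\<close>

definition left_site :: "nat \<Rightarrow> nat \<Rightarrow> nat" where
  "left_site n a = (if a = 1 then n else a - 1)"

text \<open>The effect of a ring of the clock carried by the particle currently at site \<open>a\<close>.\<close>

definition tasep_ring :: "nat \<Rightarrow> nat \<Rightarrow> (nat \<Rightarrow> nat) \<Rightarrow> (nat \<Rightarrow> nat)" where
  "tasep_ring n a w =
     (if w (left_site n a) > w a
      then w(left_site n a := w a, a := w (left_site n a))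
      else w)"

text \<open>
  All clocks are independent of rate 1, so the jump rate from \<open>w\<close> to a different state \<open>w'\<close> is the
  number of particles whose clock takes \<open>w\<close> to \<open>w'\<close>. Rings that change nothing do not contribute.
\<close>

definition tasep_rate :: "nat \<Rightarrow> (nat \<Rightarrow> nat) \<Rightarrow> (nat \<Rightarrow> nat) \<Rightarrow> real" where
  "tasep_rate n w w' =
     (if w' = w then 0 else real (card {a \<in> {1..n}. tasep_ring n a w = w'}))"

definition tasep_generator :: "nat \<Rightarrow> (nat \<Rightarrow> nat) \<Rightarrow> (nat \<Rightarrow> nat) \<Rightarrow> real" where
  "tasep_generator n w w' =
     (if w' = w then - (\<Sum>v | v permutes {1..n}. tasep_rate n w v) else tasep_rate n w w')"

text \<open>
  Stationarity of a probability distribution \<open>\<pi>\<close> for the finite-state continuous-time chain with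
  generator \<open>Q\<close>: \<open>\<pi> Q = 0\<close>.
\<close>

definition tasep_stationary :: "nat \<Rightarrow> (nat \<Rightarrow> nat) pmf \<Rightarrow> bool" where
  "tasep_stationary n \<pi> \<longleftrightarrow>
     set_pmf \<pi> \<subseteq> {w. w permutes {1..n}} \<and>
     (\<forall>w'. w' permutes {1..n} \<longrightarrow>
        (\<Sum>w | w permutes {1..n}. pmf \<pi> w * tasep_generator n w w') = 0)"

end

theory Submission
  imports Defs
begin

text \<open>
  For thresholds \<open>a \<le> b \<le> c\<close> the sets of sites with species at most \<open>a\<close>, \<open>b\<close> and \<open>c\<close> form three
  coupled one-species processes, driven by the same rings. Their joint stationary law is that of the
  output of a Ferrari--Martin multiline queue with three independent uniform rows of \<open>a\<close>, \<open>b\<close> and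
  \<open>c\<close> particles: a ring at the bottom row propagates upwards through the rows, this step is a
  bijection of pairs (rows, site), and the output of the queue follows the coupled dynamics.

  The probability in question is a third difference in \<open>(a, b, c)\<close> of the probability that the first
  and third sites carry species in \<open>{b<..c}\<close> and \<open>{a<..c}\<close> and the second one a species above \<open>c\<close>. For
  the multiline queue this event says that the queues are empty at the last site, that is, every
  final segment of a row contains at most as many particles as the same segment of the row below.
  Such rows are counted by \<open>3 \<times> 3\<close> determinants of binomial coefficients, apart from a term that does
  not depend on \<open>a\<close> after normalisation. The event is impossible when \<open>b = c\<close>, while the determinant
  formula does not vanish there; this is why \<open>k = j + 1\<close> is exceptional.
\<close>

subsection \<open>The queue on a ring\<close>

text \<open>Only three species occur in the event, so merging species into four classes by
  thresholds loses nothing. The upper bound \<open>c\<close> at sites 1 and 3 leaves the third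
  difference unchanged, because the differences in \<open>a\<close> and \<open>b\<close> cancel what
  it adds; it is imposed because a bottom row with services at 1 and 3 and none at 2 can be analysed
  site by site.

  The stationary law is given, not constructed, so the queue is compared with it through uniqueness.
  The chain on all triples of sets of given sizes is in general not irreducible; one state that lies
  in every nonempty closed set is enough.

  Dividing a determinant by the three binomial coefficients turns each entry into a cubic polynomial
  in one threshold, up to the factor \<open>n (n - 1) (n - 2)\<close> per row. The sum of
  determinants is linear in the entries of each threshold, so the third difference becomes a
  polynomial identity, and the cube of that factor is the source of the denominators.\<close>

definition right_site :: "nat \<Rightarrow> nat \<Rightarrow> nat" where
  "right_site n a = (if a = n then 1 else a + 1)"

definition hop :: "nat \<Rightarrow> nat \<Rightarrow> nat set \<Rightarrow> nat set" where
  "hop n s A = (if s \<in> A \<and> left_site n s \<notin> A then insert (left_site n s) (A - {s}) else A)"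

text \<open>Time runs along the ring in the order of the sites, with arrivals \<open>A\<close> and
  services \<open>S\<close>; an arrival can be served at its own site. Truncated subtraction
  expresses that a service finding nobody is lost. When the rows have equal size, a constant can be
  added to a solution; the required zero singles out the least one.\<close>

definition ring_queue :: "nat \<Rightarrow> nat set \<Rightarrow> nat set \<Rightarrow> (nat \<Rightarrow> nat) \<Rightarrow> bool" where
  "ring_queue n A S q \<longleftrightarrow>
     (\<forall>t\<in>{1..n}. q t = q (left_site n t) + of_bool (t \<in> A) - of_bool (t \<in> S)) \<and>
     (\<exists>t\<in>{1..n}. q t = 0)"

lemma left_site_in: "t \<in> {1..n} \<Longrightarrow> left_site n t \<in> {1..n}"
  by (auto simp: left_site_def)

lemma right_site_in: "t \<in> {1..n} \<Longrightarrow> right_site n t \<in> {1..n}"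
  by (auto simp: right_site_def)

lemma left_right_site: "t \<in> {1..n} \<Longrightarrow> left_site n (right_site n t) = t"
  by (auto simp: right_site_def left_site_def)

lemma right_left_site: "t \<in> {1..n} \<Longrightarrow> right_site n (left_site n t) = t"
  by (auto simp: right_site_def left_site_def)

lemma bij_betw_left_site: "bij_betw (left_site n) {1..n} {1..n}"
  by (rule bij_betw_byWitness[where f' = "right_site n"])
    (use left_site_in right_site_in left_right_site right_left_site in auto)

lemma ring_induct:
  assumes t0: "t0 \<in> {1..n}" "P t0"
    and step: "\<And>t. t \<in> {1..n} \<Longrightarrow> P (left_site n t) \<Longrightarrow> P t"
    and t: "t \<in> {1..n}"
  shows "P t"
proof -
  have up: "P v" if "u \<le> v" "1 \<le> u" "v \<le> n" "P u" for u v
    using that(1,3,4)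
  proof (induction v rule: dec_induct)
    case (step v)
    then show ?case
      using \<open>1 \<le> u\<close> assms(3)[of "Suc v"] by (auto simp: left_site_def)
  qed
  have "P n" using up[of t0 n] t0 by auto
  then have "P 1" using step[of 1] t0 by (auto simp: left_site_def)
  then show ?thesis using up[of 1 t] t by auto
qed

text \<open>The comparison starts at a site where \<open>p\<close> vanishes and is carried around
  the ring, since one step of the recursion is monotone in the load and in the arrivals. For
  \<open>A = B\<close> it gives uniqueness.\<close>

lemma ring_queue_mono:
  assumes p: "ring_queue n A S p" and q: "ring_queue n B S q" and AB: "A \<subseteq> B"
    and t: "t \<in> {1..n}"
  shows "p t \<le> q t"
proof -
  obtain t0 where t0: "t0 \<in> {1..n}" "p t0 = 0" using p by (auto simp: ring_queue_def)
  show ?thesis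
  proof (rule ring_induct[where P = "\<lambda>t. p t \<le> q t", OF t0(1) _ _ t])
    show "p t0 \<le> q t0" using t0 by simp
    fix t assume t: "t \<in> {1..n}" and le: "p (left_site n t) \<le> q (left_site n t)"
    have "of_bool (t \<in> A) \<le> (of_bool (t \<in> B) :: nat)" using AB by auto
    then show "p t \<le> q t"
      using p q t le unfolding ring_queue_def
      by (metis (no_types, lifting) add_mono diff_le_mono)
  qed
qed

lemma ring_queue_unique:
  assumes "ring_queue n A S p" and "ring_queue n A S q" and "t \<in> {1..n}"
  shows "p t = q t"
  by (metis assms dual_order.antisym order_refl ring_queue_mono)

section \<open>Existence of the cyclic queue, and its departures\<close>

primrec queue_run :: "nat set \<Rightarrow> nat set \<Rightarrow> nat \<Rightarrow> nat \<Rightarrow> nat" where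
  "queue_run A S r 0 = r"
| "queue_run A S r (Suc t) = queue_run A S r t + of_bool (Suc t \<in> A) - of_bool (Suc t \<in> S)"

lemma card_Int_Suc:
  "card (A \<inter> {1..Suc t}) = card (A \<inter> {1..t}) + of_bool (Suc t \<in> A)"
proof -
  have "A \<inter> {1..Suc t} = (if Suc t \<in> A then insert (Suc t) (A \<inter> {1..t}) else A \<inter> {1..t})"
    by (auto simp: le_Suc_eq)
  then show ?thesis by simp
qed

text \<open>An initial load of at least \<open>t\<close> cannot run out before site
  \<open>t\<close>, so no service up to there is lost and the balance is exact.\<close>

lemma queue_run_large:
  "t \<le> r \<Longrightarrow> queue_run A S r t + card (S \<inter> {1..t}) = r + card (A \<inter> {1..t})"
proof (induction t)
  case (Suc t)
  have "card (S \<inter> {1..t}) \<le> t"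
    using card_mono[of "{1..t}" "S \<inter> {1..t}"] by simp
  then have "1 \<le> queue_run A S r t" using Suc by simp
  then show ?case using Suc unfolding card_Int_Suc by (simp split: if_splits)
qed simp

text \<open>While the load stays positive no service is lost, so one waiting customer can be taken
  out of the whole run.\<close>

lemma queue_run_pred:
  assumes "\<forall>u\<le>t. 0 < queue_run A S r u"
  shows "queue_run A S (r - 1) t = queue_run A S r t - 1"
  using assms
proof (induction t)
  case (Suc t)
  then have "queue_run A S (r - 1) t = queue_run A S r t - 1" by simp
  moreover have "0 < queue_run A S r t" "0 < queue_run A S r (Suc t)" using Suc.prems by auto
  ultimately show ?case by simp
qed simp

text \<open>The least load that one revolution does not increase is reproduced by that revolution, and by
  minimality the queue runs empty on the way.\<close>

lemma ring_queue_exists: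
  assumes A: "A \<subseteq> {1..n}" and S: "S \<subseteq> {1..n}" and le: "card A \<le> card S" and n: "0 < n"
  shows "\<exists>q. ring_queue n A S q"
proof -
  define g where "g r = queue_run A S r n" for r
  have mono: "g r \<le> g r'" if "r \<le> r'" for r r'
  proof -
    have "queue_run A S r t \<le> queue_run A S r' t" for t
      by (induction t) (use that in \<open>auto simp: diff_le_mono\<close>)
    then show ?thesis by (simp add: g_def)
  qed
  have "A \<inter> {1..n} = A" "S \<inter> {1..n} = S" using A S by auto
  then have "g n + card S = n + card A" using queue_run_large[of n n A S] by (simp add: g_def)
  then have "g n \<le> n" using le by simp
  define r where "r = (LEAST r. g r \<le> r)"
  have gr: "g r \<le> r" unfolding r_def by (rule LeastI[of _ n]) fact
  then have "g (g r) \<le> g r" by (rule mono)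
  then have "r \<le> g r" unfolding r_def by (rule Least_le)
  with gr have fix_r: "g r = r" by simp
  have zero: "\<exists>t\<le>n. queue_run A S r t = 0"
  proof (rule ccontr)
    assume "\<not> ?thesis"
    then have pos: "\<forall>t\<le>n. 0 < queue_run A S r t" by auto
    then have "0 < r" by (metis queue_run.simps(1) zero_le)
    have "g (r - 1) = r - 1" using queue_run_pred[OF pos] fix_r by (simp add: g_def)
    then have "r \<le> r - 1" unfolding r_def by (intro Least_le) simp
    with \<open>0 < r\<close> show False by simp
  qed
  have "ring_queue n A S (queue_run A S r)"
    unfolding ring_queue_def
  proof
    show "\<forall>t\<in>{1..n}. queue_run A S r t =
        queue_run A S r (left_site n t) + of_bool (t \<in> A) - of_bool (t \<in> S)"
    proof
      fix t assume t: "t \<in> {1..n}"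
      then obtain t' where t': "t = Suc t'" by (cases t) auto
      have "queue_run A S r (left_site n t) = queue_run A S r t'"
        using fix_r t' by (auto simp: left_site_def g_def)
      then show "queue_run A S r t =
          queue_run A S r (left_site n t) + of_bool (t \<in> A) - of_bool (t \<in> S)"
        unfolding t' by simp
    qed
    obtain t where t: "t \<le> n" "queue_run A S r t = 0" using zero by auto
    show "\<exists>t\<in>{1..n}. queue_run A S r t = 0"
    proof (cases "t = 0")
      case True
      then have "queue_run A S r n = 0" using t fix_r by (simp add: g_def)
      then show ?thesis using n by (intro bexI[of _ n]) auto
    next
      case False
      then show ?thesis using t by auto
    qed
  qed
  then show ?thesis by blast
qed

text \<open>\<open>SOME\<close> makes this total; the value is meaningful where a queue exists, and
  by uniqueness any solution may then replace it.\<close>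

definition queue_length :: "nat \<Rightarrow> nat set \<Rightarrow> nat set \<Rightarrow> nat \<Rightarrow> nat" where
  "queue_length n A S = (SOME q. ring_queue n A S q)"

definition departures :: "nat \<Rightarrow> nat set \<Rightarrow> nat set \<Rightarrow> nat set" where
  "departures n A S =
     {t \<in> {1..n}. t \<in> S \<and> (0 < queue_length n A S (left_site n t) \<or> t \<in> A)}"

lemma departures_eq:
  assumes q: "ring_queue n A S q"
  shows "departures n A S = {t \<in> {1..n}. t \<in> S \<and> (0 < q (left_site n t) \<or> t \<in> A)}"
proof -
  have "ring_queue n A S (queue_length n A S)"
    unfolding queue_length_def by (rule someI[of "ring_queue n A S", OF q])
  then have "queue_length n A S (left_site n t) = q (left_site n t)" if "t \<in> {1..n}" for t
    using ring_queue_unique[OF _ q] left_site_in[OF that] by blast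
  then show ?thesis by (auto simp: departures_def)
qed

lemma departures_subset: "departures n A S \<subseteq> S" "departures n A S \<subseteq> {1..n}"
  by (auto simp: departures_def)

text \<open>Each site conserves customers: load after plus departure equals load before plus
  arrival. Summed around the ring, the loads cancel.\<close>

lemma card_departures:
  assumes A: "A \<subseteq> {1..n}" and q: "ring_queue n A S q"
  shows "card (departures n A S) = card A"
proof -
  have dep: "q t + of_bool (t \<in> departures n A S) = q (left_site n t) + of_bool (t \<in> A)"
    if "t \<in> {1..n}" for t
  proof -
    have "q t = q (left_site n t) + of_bool (t \<in> A) - of_bool (t \<in> S)"
      using q that by (simp add: ring_queue_def)
    moreover have "t \<in> departures n A S \<longleftrightarrow> t \<in> S \<and> (0 < q (left_site n t) \<or> t \<in> A)"
      using that by (simp add: departures_eq[OF q])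
    ultimately show ?thesis by (cases "t \<in> A"; cases "t \<in> S") auto
  qed
  have "(\<Sum>t\<in>{1..n}. q (left_site n t)) = (\<Sum>t\<in>{1..n}. q t)"
    by (rule sum.reindex_bij_betw[OF bij_betw_left_site])
  moreover have "(\<Sum>t\<in>{1..n}. q t + of_bool (t \<in> departures n A S))
      = (\<Sum>t\<in>{1..n}. q (left_site n t) + of_bool (t \<in> A))"
    by (rule sum.cong) (use dep in auto)
  ultimately have "(\<Sum>t\<in>{1..n}. of_bool (t \<in> departures n A S))
      = (\<Sum>t\<in>{1..n}. of_bool (t \<in> A) :: nat)"
    by (simp add: sum.distrib)
  moreover have "{1..n} \<inter> {t. t \<in> departures n A S} = departures n A S" "{1..n} \<inter> {t. t \<in> A} = A"
    using A departures_subset(2)[of n A S] by auto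
  ultimately show ?thesis by simp
qed

section \<open>Commutation of rings with departures\<close>

lemma hop_subset: "A \<subseteq> {1..n} \<Longrightarrow> s \<in> {1..n} \<Longrightarrow> hop n s A \<subseteq> {1..n}"
  using left_site_in by (auto simp: hop_def)

lemma card_hop:
  assumes "finite A" shows "card (hop n s A) = card A"
proof (cases "s \<in> A \<and> left_site n s \<notin> A")
  case True
  then have "left_site n s \<notin> A - {s}" by simp
  then have "card (hop n s A) = Suc (card (A - {s}))"
    using True assms by (simp add: hop_def)
  also have "\<dots> = card A" using True assms by (meson card_Suc_Diff1)
  finally show ?thesis .
qed (auto simp: hop_def)

text \<open>The site at which the clock rings in the row above, when the row \<open>S\<close> is rung at site \<open>s\<close>.\<close>

definition ring_above :: "nat \<Rightarrow> nat set \<Rightarrow> nat \<Rightarrow> nat" where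
  "ring_above n S s = (if s \<in> S then s else right_site n s)"

lemma ring_above_in: "s \<in> {1..n} \<Longrightarrow> ring_above n S s \<in> {1..n}"
  using right_site_in by (auto simp: ring_above_def)

lemma left_site_neq: "3 \<le> n \<Longrightarrow> t \<in> {1..n} \<Longrightarrow> left_site n t \<noteq> t"
  by (auto simp: left_site_def)

lemma left_left_site_neq: "3 \<le> n \<Longrightarrow> t \<in> {1..n} \<Longrightarrow> left_site n (left_site n t) \<noteq> t"
  by (auto simp: left_site_def)

lemma left_site_inj: "s \<in> {1..n} \<Longrightarrow> t \<in> {1..n} \<Longrightarrow> left_site n s = left_site n t \<Longrightarrow> s = t"
  by (metis right_left_site)

lemma hop_iff:
  assumes "left_site n s \<noteq> s"
  shows "t \<in> hop n s A \<longleftrightarrow>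
    (if t = left_site n s then t \<in> A \<or> s \<in> A
     else if t = s then s \<in> A \<and> left_site n s \<in> A else t \<in> A)"
  using assms by (auto simp: hop_def)

text \<open>Together, \<open>s\<close> and its left neighbour \<open>l\<close> have the same
  arrivals and services before and after the ring. Only the load between them changes:
  \<open>q'\<close> differs from \<open>q\<close> at \<open>l\<close> alone, and the load at
  \<open>s\<close> comes out the same.\<close>

lemma departures_hop_served:
  assumes n: "3 \<le> n" and q: "ring_queue n A S q" and s: "s \<in> {1..n}" "s \<in> S"
  shows "departures n (hop n s A) (hop n s S) = hop n s (departures n A S)"
proof -
  define l where "l = left_site n s"
  define m where "m = left_site n l"
  have l: "l \<in> {1..n}" "l \<noteq> s" and m: "m \<in> {1..n}" "m \<noteq> l" "m \<noteq> s"
    using n s left_site_in left_site_neq left_left_site_neq by (auto simp: l_def m_def)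
  have iff: "t \<in> hop n s B \<longleftrightarrow>
      (if t = l then l \<in> B \<or> s \<in> B else if t = s then s \<in> B \<and> l \<in> B else t \<in> B)" for t B
    using hop_iff[of n s t B] l by (auto simp: l_def)
  define q' where "q' = q(l := q m + of_bool (l \<in> hop n s A) - of_bool (l \<in> hop n s S))"
  have rec: "q t = q (left_site n t) + of_bool (t \<in> A) - of_bool (t \<in> S)" if "t \<in> {1..n}" for t
    using q that by (auto simp: ring_queue_def)
  have ql: "q l = q m + of_bool (l \<in> A) - of_bool (l \<in> S)"
    and qs: "q s = q l + of_bool (s \<in> A) - 1"
    using rec[OF l(1)] rec[OF s(1)] s by (auto simp: m_def l_def)
  have q'l: "q' l = q m + of_bool (l \<in> A \<or> s \<in> A) - 1"
    using s by (simp add: q'_def iff)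
  have q's: "q s = q' l + of_bool (s \<in> A \<and> l \<in> A) - of_bool (l \<in> S)"
    unfolding q'l qs ql by (cases "s \<in> A"; cases "l \<in> A"; cases "l \<in> S") auto
  have other: "left_site n t \<noteq> l" if "t \<in> {1..n}" "t \<noteq> s" for t
    using left_site_inj[of s n t] that s by (auto simp: l_def)
  have Q': "ring_queue n (hop n s A) (hop n s S) q'"
    unfolding ring_queue_def
  proof
    show "\<forall>t\<in>{1..n}. q' t = q' (left_site n t) + of_bool (t \<in> hop n s A) - of_bool (t \<in> hop n s S)"
    proof
      fix t assume t: "t \<in> {1..n}"
      consider "t = l" | "t = s" | "t \<noteq> l" "t \<noteq> s" by blast
      then show "q' t = q' (left_site n t) + of_bool (t \<in> hop n s A) - of_bool (t \<in> hop n s S)"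
      proof cases
        case 1
        then show ?thesis using m by (simp add: q'_def m_def[symmetric])
      next
        case 2
        have "q' s = q s" using l by (simp add: q'_def)
        then show ?thesis using 2 q's l s by (simp add: l_def[symmetric] iff)
      next
        case 3
        then show ?thesis using other[OF t] rec[OF t] by (simp add: q'_def iff)
      qed
    qed
    obtain t0 where t0: "t0 \<in> {1..n}" "q t0 = 0" using q by (auto simp: ring_queue_def)
    show "\<exists>t\<in>{1..n}. q' t = 0"
    proof (cases "t0 = l")
      case False
      then show ?thesis using t0 by (auto simp: q'_def)
    next
      case True
      \<comment> \<open>The required zero may have been at \<open>l\<close>, the one site whose load
        changes; a zero is then found at \<open>l\<close> again or at \<open>s\<close>.\<close>
      then have "q' l = 0 \<or> q s = 0"
        using t0 ql q'l qs by (cases "s \<in> A"; cases "l \<in> A"; cases "l \<in> S") auto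
      then show ?thesis
      proof
        assume "q s = 0"
        then have "q' s = 0" using l by (simp add: q'_def)
        then show ?thesis using s by blast
      qed (use l in blast)
    qed
  qed
  have D: "t \<in> departures n A S \<longleftrightarrow> t \<in> {1..n} \<and> t \<in> S \<and> (0 < q (left_site n t) \<or> t \<in> A)" for t
    by (simp add: departures_eq[OF q])
  show ?thesis
  proof (rule set_eqI)
    fix t
    have D': "t \<in> departures n (hop n s A) (hop n s S) \<longleftrightarrow>
        t \<in> {1..n} \<and> t \<in> hop n s S \<and> (0 < q' (left_site n t) \<or> t \<in> hop n s A)"
      by (simp add: departures_eq[OF Q'])
    consider "t = l" | "t = s" | "t \<noteq> l" "t \<noteq> s" by blast
    then show "t \<in> departures n (hop n s A) (hop n s S) \<longleftrightarrow> t \<in> hop n s (departures n A S)"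
    proof cases
      case 1
      have "l \<in> departures n A S \<longleftrightarrow> l \<in> S \<and> (0 < q m \<or> l \<in> A)"
        "s \<in> departures n A S \<longleftrightarrow> 0 < q l \<or> s \<in> A"
        using l s by (auto simp: D m_def l_def)
      moreover have "q' (left_site n l) = q m"
        using m by (simp add: q'_def m_def[symmetric])
      ultimately show ?thesis
        unfolding 1 D'[unfolded 1] iff using l s ql by (cases "l \<in> S") auto
    next
      case 2
      have "l \<in> departures n A S \<longleftrightarrow> l \<in> S \<and> (0 < q m \<or> l \<in> A)"
        "s \<in> departures n A S \<longleftrightarrow> 0 < q l \<or> s \<in> A"
        using l s by (auto simp: D m_def l_def)
      then show ?thesis
        unfolding 2 D'[unfolded 2] iff l_def[symmetric] q'l using l s ql
        by (cases "l \<in> S"; cases "l \<in> A"; cases "s \<in> A") auto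
    next
      case 3
      then show ?thesis
        unfolding D' iff D using other by (auto simp: q'_def)
    qed
  qed
qed

text \<open>With no service at \<open>s\<close>, an arrival at \<open>s\<close> waits for the next
  site \<open>r\<close> anyway. Pulling an arrival from \<open>r\<close> back to \<open>s\<close>
  changes the load at \<open>s\<close> and no departure.\<close>

lemma departures_hop_unserved:
  assumes n: "3 \<le> n" and q: "ring_queue n A S q" and s: "s \<in> {1..n}" "s \<notin> S"
  shows "departures n (hop n (right_site n s) A) S = departures n A S"
proof -
  define r where "r = right_site n s"
  define m where "m = left_site n s"
  have r: "r \<in> {1..n}" "left_site n r = s" "r \<noteq> s" and m: "m \<in> {1..n}" "m \<noteq> s"
    using n s right_site_in left_site_in left_right_site left_site_neq[of n r] left_site_neq[of n s]
    by (auto simp: r_def m_def)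
  have iff: "t \<in> hop n r B \<longleftrightarrow>
      (if t = s then s \<in> B \<or> r \<in> B else if t = r then r \<in> B \<and> s \<in> B else t \<in> B)" for t B
    using hop_iff[of n r t B] r by auto
  have rec: "q t = q (left_site n t) + of_bool (t \<in> A) - of_bool (t \<in> S)" if "t \<in> {1..n}" for t
    using q that by (auto simp: ring_queue_def)
  have qs: "q s = q m + of_bool (s \<in> A)"
    and qr: "q r = q s + of_bool (r \<in> A) - of_bool (r \<in> S)"
    using rec[OF s(1)] rec[OF r(1)] s r by (auto simp: m_def)
  define q' where "q' = q(s := q m + of_bool (s \<in> A \<or> r \<in> A))"
  have q's: "q' s = q m + of_bool (s \<in> A \<or> r \<in> A)" by (simp add: q'_def)
  have other: "left_site n t \<noteq> s" if "t \<in> {1..n}" "t \<noteq> r" for t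
    using left_site_inj[of r n t] that r by auto
  have Q': "ring_queue n (hop n r A) S q'"
    unfolding ring_queue_def
  proof
    show "\<forall>t\<in>{1..n}. q' t = q' (left_site n t) + of_bool (t \<in> hop n r A) - of_bool (t \<in> S)"
    proof
      fix t assume t: "t \<in> {1..n}"
      consider "t = s" | "t = r" | "t \<noteq> s" "t \<noteq> r" by blast
      then show "q' t = q' (left_site n t) + of_bool (t \<in> hop n r A) - of_bool (t \<in> S)"
      proof cases
        case 1
        then show ?thesis using m s by (simp add: q'_def m_def[symmetric] iff)
      next
        case 2
        have "q' r = q r" using r by (simp add: q'_def)
        then show ?thesis unfolding 2 r(2) q's qr qs using r by (auto simp: iff)
      next
        case 3
        then show ?thesis using other[OF t] rec[OF t] by (simp add: q'_def iff)
      qed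
    qed
    obtain t0 where t0: "t0 \<in> {1..n}" "q t0 = 0" using q by (auto simp: ring_queue_def)
    show "\<exists>t\<in>{1..n}. q' t = 0"
    proof (cases "t0 = s")
      case False
      then show ?thesis using t0 by (auto simp: q'_def)
    next
      case True
      then have "q' m = 0" using t0 qs m by (simp add: q'_def)
      then show ?thesis using m by blast
    qed
  qed
  show ?thesis
    unfolding r_def[symmetric]
  proof (rule set_eqI)
    fix t
    have D: "t \<in> departures n A S \<longleftrightarrow> t \<in> {1..n} \<and> t \<in> S \<and> (0 < q (left_site n t) \<or> t \<in> A)"
      by (simp add: departures_eq[OF q])
    have D': "t \<in> departures n (hop n r A) S \<longleftrightarrow>
        t \<in> {1..n} \<and> t \<in> S \<and> (0 < q' (left_site n t) \<or> t \<in> hop n r A)"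
      by (simp add: departures_eq[OF Q'])
    consider "t = s" | "t = r" | "t \<noteq> s" "t \<noteq> r" by blast
    then show "t \<in> departures n (hop n r A) S \<longleftrightarrow> t \<in> departures n A S"
    proof cases
      case 1
      then show ?thesis using s departures_subset(1) by blast
    next
      case 2
      show ?thesis
        unfolding D[unfolded 2] D'[unfolded 2] 2 r(2) q's qs using r by (auto simp: iff)
    next
      case 3
      then show ?thesis
        unfolding D' iff D using other by (auto simp: q'_def)
    qed
  qed
qed

text \<open>At a site without service the ring is idle for \<open>S\<close> and for the output. It
  is passed on to the right neighbour in the row above, where it does not disturb the output either;
  this choice keeps the combined step injective.\<close>

lemma departures_hop:
  assumes n: "3 \<le> n" and q: "ring_queue n A S q" and s: "s \<in> {1..n}"
  shows "departures n (hop n (ring_above n S s) A) (hop n s S) = hop n s (departures n A S)"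
proof (cases "s \<in> S")
  case True
  then show ?thesis using departures_hop_served[OF n q s] by (simp add: ring_above_def)
next
  case False
  then have "hop n s S = S" "hop n s (departures n A S) = departures n A S"
    using departures_subset(1)[of n A S] by (auto simp: hop_def)
  then show ?thesis using departures_hop_unserved[OF n q s False] False by (simp add: ring_above_def)
qed

text \<open>The site just left of \<open>ring_above n S s\<close> tells the two cases apart after
  the hop: it is occupied if \<open>s\<close> was in \<open>S\<close>, and otherwise it is the empty
  site \<open>s\<close> itself. Each case can then be undone.\<close>

lemma hop_ring_above_inj:
  assumes n: "3 \<le> n" and s: "s \<in> {1..n}" and t: "t \<in> {1..n}"
    and hop: "hop n s S = hop n t T" and above: "ring_above n S s = ring_above n T t"
  shows "S = T \<and> s = t"
proof -
  have *: "left_site n (ring_above n S s) \<in> hop n s S \<longleftrightarrow> s \<in> S" if "s \<in> {1..n}" for s S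
    using hop_iff[OF left_site_neq[OF n that], of "left_site n s" S] left_right_site[OF that]
    by (auto simp: ring_above_def hop_def)
  then have iff: "s \<in> S \<longleftrightarrow> t \<in> T" using hop above s t by metis
  show ?thesis
  proof (cases "s \<in> S")
    case True
    then have "s = t" "t \<in> T" using above iff by (auto simp: ring_above_def)
    have "u \<in> S \<longleftrightarrow> u \<in> T" for u
    proof -
      \<comment> \<open>After a served ring \<open>s\<close> is still occupied exactly when its left
        neighbour was occupied before.\<close>
      have "left_site n s \<in> S \<longleftrightarrow> left_site n s \<in> T"
        using hop_iff[OF left_site_neq[OF n s], of s] hop True \<open>s = t\<close> \<open>t \<in> T\<close> left_site_neq[OF n s]
        by metis
      moreover have "u \<in> S \<longleftrightarrow> u \<in> T" if "u \<noteq> s" "u \<noteq> left_site n s"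
        using hop_iff[OF left_site_neq[OF n s], of u] hop that \<open>s = t\<close> by metis
      ultimately show ?thesis using True \<open>s = t\<close> \<open>t \<in> T\<close> by blast
    qed
    then show ?thesis using \<open>s = t\<close> by blast
  next
    case False
    then have "right_site n s = right_site n t" using above iff by (auto simp: ring_above_def)
    then have "s = t" using left_right_site s t by metis
    then show ?thesis using hop False iff by (simp add: hop_def)
  qed
qed

subsection \<open>Uniqueness of invariant weights\<close>

text \<open>Mass balance for the set \<open>P\<close> on which \<open>d\<close> is positive: the
  points outside \<open>P\<close> bring in a nonpositive amount, so \<open>P\<close> keeps its mass
  only if none of it leaves.\<close>

lemma invariant_positive_closed:
  fixes d :: "'b \<Rightarrow> real" and T :: "'i \<Rightarrow> 'b \<Rightarrow> 'b"
  assumes \<Omega>: "finite \<Omega>" and I: "finite I"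
    and T: "\<And>s x. s \<in> I \<Longrightarrow> x \<in> \<Omega> \<Longrightarrow> T s x \<in> \<Omega>"
    and inv: "\<And>y. y \<in> \<Omega> \<Longrightarrow> (\<Sum>s\<in>I. \<Sum>x\<in>\<Omega>. of_bool (T s x = y) * d x) = real (card I) * d y"
    and s: "s \<in> I" and x: "x \<in> \<Omega>" "0 < d x"
  shows "0 < d (T s x)"
proof (rule ccontr)
  assume neg: "\<not> 0 < d (T s x)"
  define P where "P = {y\<in>\<Omega>. 0 < d y}"
  have P: "finite P" "P \<subseteq> \<Omega>" using \<Omega> by (auto simp: P_def)
  have flow: "(\<Sum>y\<in>P. \<Sum>x\<in>\<Omega>. of_bool (T s x = y) * d x) = (\<Sum>x\<in>\<Omega>. of_bool (T s x \<in> P) * d x)" for s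
  proof -
    have "(\<Sum>y\<in>P. of_bool (T s x = y) * d x) = of_bool (T s x \<in> P) * d x" for x
      using P(1) by (simp add: sum_distrib_right[symmetric])
    then show ?thesis by (subst sum.swap) simp
  qed
  have le: "(\<Sum>x\<in>\<Omega>. of_bool (T s x \<in> P) * d x) \<le> (\<Sum>x\<in>P. of_bool (T s x \<in> P) * d x)" for s
  proof -
    have "(\<Sum>x\<in>\<Omega>. of_bool (T s x \<in> P) * d x) =
        (\<Sum>x\<in>P. of_bool (T s x \<in> P) * d x) + (\<Sum>x\<in>\<Omega> - P. of_bool (T s x \<in> P) * d x)"
      using P \<Omega> by (metis (no_types, lifting) add.commute sum.subset_diff)
    moreover have "(\<Sum>x\<in>\<Omega> - P. of_bool (T s x \<in> P) * d x) \<le> 0"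
      by (rule sum_nonpos) (auto simp: P_def)
    ultimately show ?thesis by simp
  qed
  have le': "(\<Sum>x\<in>P. of_bool (T s x \<in> P) * d x) \<le> (\<Sum>x\<in>P. d x)" for s
    by (rule sum_mono) (auto simp: P_def)
  have less: "(\<Sum>x\<in>P. of_bool (T s x \<in> P) * d x) < (\<Sum>x\<in>P. d x)"
    by (rule sum_strict_mono_ex1) (use P x neg in \<open>auto simp: P_def intro!: bexI[of _ x]\<close>)
  have "real (card I) * (\<Sum>y\<in>P. d y) = (\<Sum>y\<in>P. \<Sum>s\<in>I. \<Sum>x\<in>\<Omega>. of_bool (T s x = y) * d x)"
    unfolding sum_distrib_left by (rule sum.cong) (use inv P in auto)
  also have "\<dots> = (\<Sum>s\<in>I. \<Sum>x\<in>\<Omega>. of_bool (T s x \<in> P) * d x)"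
    by (subst sum.swap) (simp only: flow)
  also have "\<dots> < (\<Sum>s\<in>I. \<Sum>x\<in>P. d x)"
    by (rule sum_strict_mono_ex1)
      (use I s le[THEN order_trans, OF le'] le[THEN order.strict_trans1, OF less] in auto)
  finally show False by simp
qed

text \<open>If \<open>d\<close> took both signs, its positive and its negative points would form two
  nonempty closed sets, and \<open>z\<close> would lie in both. So \<open>d\<close> has one sign,
  and total mass 0 makes it vanish.\<close>

lemma invariant_unique:
  fixes d :: "'b \<Rightarrow> real" and T :: "'i \<Rightarrow> 'b \<Rightarrow> 'b"
  assumes \<Omega>: "finite \<Omega>" and I: "finite I"
    and T: "\<And>s x. s \<in> I \<Longrightarrow> x \<in> \<Omega> \<Longrightarrow> T s x \<in> \<Omega>"
    and inv: "\<And>y. y \<in> \<Omega> \<Longrightarrow> (\<Sum>s\<in>I. \<Sum>x\<in>\<Omega>. of_bool (T s x = y) * d x) = real (card I) * d y"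
    and sum: "(\<Sum>x\<in>\<Omega>. d x) = 0"
    and reach: "\<And>C. C \<subseteq> \<Omega> \<Longrightarrow> C \<noteq> {} \<Longrightarrow> (\<And>s x. s \<in> I \<Longrightarrow> x \<in> C \<Longrightarrow> T s x \<in> C) \<Longrightarrow> z \<in> C"
    and x: "x \<in> \<Omega>"
  shows "d x = 0"
proof -
  have inv': "(\<Sum>s\<in>I. \<Sum>x\<in>\<Omega>. of_bool (T s x = y) * - d x) = real (card I) * - d y"
    if "y \<in> \<Omega>" for y
    using inv[OF that] by (simp add: sum_negf)
  have pos: "0 < d z" if "y \<in> \<Omega>" "0 < d y" for y
  proof -
    have "z \<in> {x\<in>\<Omega>. 0 < d x}"
      by (rule reach) (use that T invariant_positive_closed[OF \<Omega> I T inv] in auto)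
    then show ?thesis by simp
  qed
  have neg: "0 < - d z" if "y \<in> \<Omega>" "0 < - d y" for y
  proof -
    have "z \<in> {x\<in>\<Omega>. 0 < - d x}"
      by (rule reach) (use that T invariant_positive_closed[OF \<Omega> I T inv'] in auto)
    then show ?thesis by simp
  qed
  have "(\<forall>y\<in>\<Omega>. 0 \<le> d y) \<or> (\<forall>y\<in>\<Omega>. 0 \<le> - d y)"
    using pos neg by fastforce
  then show ?thesis
  proof
    assume "\<forall>y\<in>\<Omega>. 0 \<le> d y"
    then show ?thesis using sum_nonneg_eq_0_iff[OF \<Omega>, of d] sum x by auto
  next
    assume "\<forall>y\<in>\<Omega>. 0 \<le> - d y"
    then show ?thesis using sum_nonneg_eq_0_iff[OF \<Omega>, of "\<lambda>x. - d x"] sum x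
      by (auto simp: sum_negf)
  qed
qed

section \<open>Triples of sets and sorting by rings\<close>

lemma initial_segmentI:
  assumes "A \<subseteq> {1..n}" and down: "\<And>s. 2 \<le> s \<Longrightarrow> s \<in> A \<Longrightarrow> s - 1 \<in> A"
  shows "A = {1..card A}"
proof (cases "A = {}")
  case False
  have fin: "finite A" using assms(1) finite_subset by blast
  define M where "M = Max A"
  have M: "M \<in> A" "\<And>x. x \<in> A \<Longrightarrow> x \<le> M" using fin False by (auto simp: M_def)
  have "M - k \<in> A" if "k < M" for k
    using that
  proof (induction k)
    case (Suc k)
    then show ?case using down[of "M - k"] by simp
  qed (use M in simp)
  then have "x \<in> A" if "1 \<le> x" "x \<le> M" for x
    using that by (metis Suc_le_eq diff_diff_cancel diff_less less_le_trans One_nat_def)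
  then have "A = {1..M}" using M assms(1) by force
  then show ?thesis by simp
qed simp

type_synonym triple = "nat set \<times> nat set \<times> nat set"

text \<open>One state space for the rows, for the outputs and for the threshold sets. Inclusions
  between the components are not imposed, as the rows are independent.\<close>

definition triples :: "nat \<Rightarrow> nat \<Rightarrow> nat \<Rightarrow> nat \<Rightarrow> triple set" where
  "triples n a b c =
     {A. A \<subseteq> {1..n} \<and> card A = a} \<times> {A. A \<subseteq> {1..n} \<and> card A = b} \<times> {A. A \<subseteq> {1..n} \<and> card A = c}"

fun hop3 :: "nat \<Rightarrow> nat \<Rightarrow> triple \<Rightarrow> triple" where
  "hop3 n s (X, Y, Z) = (hop n s X, hop n s Y, hop n s Z)"

lemma finite_triples: "finite (triples n a b c)"
proof -
  have "finite {A. A \<subseteq> {1..n} \<and> card A = k}" for k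
    by (rule finite_subset[of _ "Pow {1..n}"]) auto
  then show ?thesis by (simp add: triples_def)
qed

lemma card_triples: "card (triples n a b c) = (n choose a) * (n choose b) * (n choose c)"
  by (simp add: triples_def card_cartesian_product n_subsets)

lemma hop_in_subsets:
  "s \<in> {1..n} \<Longrightarrow> A \<in> {A. A \<subseteq> {1..n} \<and> card A = a} \<Longrightarrow> hop n s A \<in> {A. A \<subseteq> {1..n} \<and> card A = a}"
  using hop_subset[of A n s] card_hop[of A n s] by (auto intro: finite_subset)

lemma hop3_in: "s \<in> {1..n} \<Longrightarrow> x \<in> triples n a b c \<Longrightarrow> hop3 n s x \<in> triples n a b c"
  using hop_in_subsets unfolding triples_def by (cases x) auto

text \<open>The sum of positions is the potential of the sorting argument. The bound
  \<open>2 \<le> s\<close> excludes the ring that carries a particle from site 1 around to site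
  \<open>n\<close>.\<close>

lemma sum_hop_le:
  assumes "finite A" "2 \<le> s" shows "\<Sum>(hop n s A) \<le> \<Sum>A"
    and "s \<in> A \<Longrightarrow> s - 1 \<notin> A \<Longrightarrow> \<Sum>(hop n s A) < \<Sum>A"
proof -
  have l: "left_site n s = s - 1" using assms by (simp add: left_site_def)
  have less: "\<Sum>(hop n s A) < \<Sum>A" if "s \<in> A" "s - 1 \<notin> A"
  proof -
    have "\<Sum>(hop n s A) = (s - 1) + \<Sum>(A - {s})" using that assms by (simp add: hop_def l)
    also have "\<dots> < s + \<Sum>(A - {s})" using assms by simp
    also have "\<dots> = \<Sum>A" using that assms by (simp add: sum.remove)
    finally show ?thesis .
  qed
  then show "s \<in> A \<Longrightarrow> s - 1 \<notin> A \<Longrightarrow> \<Sum>(hop n s A) < \<Sum>A" .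
  show "\<Sum>(hop n s A) \<le> \<Sum>A"
  proof (cases "s \<in> A \<and> s - 1 \<notin> A")
    case False
    then show ?thesis using l by (auto simp: hop_def)
  qed (use less in auto)
qed

text \<open>Rings at the sites \<open>2, \<dots>, n\<close> sort the ring like bubble sort, so the sorted state can be reached
  from every state.\<close>

lemma sorted_reachable:
  assumes C: "C \<subseteq> triples n a b c" "C \<noteq> {}"
    and closed: "\<And>s x. s \<in> {1..n} \<Longrightarrow> x \<in> C \<Longrightarrow> hop3 n s x \<in> C"
  shows "({1..a}, {1..b}, {1..c}) \<in> C"
proof -
  define f :: "triple \<Rightarrow> nat" where "f = (\<lambda>(X, Y, Z). \<Sum>X + \<Sum>Y + \<Sum>Z)"
  \<comment> \<open>All three sets hop at once, but none of them can raise its sum, so a minimiser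
    of the total admits no descent in any of them.\<close>
  obtain x where x: "x \<in> C" "\<And>y. y \<in> C \<Longrightarrow> f x \<le> f y"
    using C(2) ex_has_least_nat[of "\<lambda>x. x \<in> C" _ f] by blast
  obtain X Y Z where xyz: "x = (X, Y, Z)" by (cases x)
  have sub: "X \<subseteq> {1..n}" "Y \<subseteq> {1..n}" "Z \<subseteq> {1..n}" and card: "card X = a" "card Y = b" "card Z = c"
    using x(1) C(1) by (auto simp: xyz triples_def)
  then have fin: "finite X" "finite Y" "finite Z" by (auto intro: finite_subset)
  have min: "\<Sum>X + \<Sum>Y + \<Sum>Z \<le> \<Sum>(hop n s X) + \<Sum>(hop n s Y) + \<Sum>(hop n s Z)"
    if "s \<in> {1..n}" for s
    using x(2)[OF closed[OF that x(1)]] by (simp add: f_def xyz)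
  have down: "s - 1 \<in> X" if "2 \<le> s" "s \<in> X" for s
    using min[of s] sum_hop_le[OF fin(1) that(1), of n] sum_hop_le(1)[OF fin(2) that(1), of n]
      sum_hop_le(1)[OF fin(3) that(1), of n] that sub by fastforce
  have down': "s - 1 \<in> Y" if "2 \<le> s" "s \<in> Y" for s
    using min[of s] sum_hop_le[OF fin(2) that(1), of n] sum_hop_le(1)[OF fin(1) that(1), of n]
      sum_hop_le(1)[OF fin(3) that(1), of n] that sub by fastforce
  have down'': "s - 1 \<in> Z" if "2 \<le> s" "s \<in> Z" for s
    using min[of s] sum_hop_le[OF fin(3) that(1), of n] sum_hop_le(1)[OF fin(2) that(1), of n]
      sum_hop_le(1)[OF fin(1) that(1), of n] that sub by fastforce
  have "X = {1..a}" using initial_segmentI[OF sub(1) down] card by simp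
  moreover have "Y = {1..b}" using initial_segmentI[OF sub(2) down'] card by simp
  moreover have "Z = {1..c}" using initial_segmentI[OF sub(3) down''] card by simp
  ultimately show ?thesis using x(1) by (simp add: xyz)
qed

subsection \<open>Multiline queues\<close>

text \<open>Unions of classes are recorded, not the classes. Priority of lower species means that
  each union is served as if the later classes were absent: for the first threshold only the
  departures from \<open>x\<^sub>2\<close> arrive at \<open>x\<^sub>3\<close>, for the second all of
  \<open>x\<^sub>2\<close>.\<close>

fun mlq_output :: "nat \<Rightarrow> triple \<Rightarrow> triple" where
  "mlq_output n (x\<^sub>1, x\<^sub>2, x\<^sub>3) =
     (departures n (departures n x\<^sub>1 x\<^sub>2) x\<^sub>3, departures n x\<^sub>2 x\<^sub>3, x\<^sub>3)"

text \<open>A ring at the bottom row travels upwards through the rows; the last component is the site at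
  which it leaves the top row, which makes the step a bijection.\<close>

fun mlq_step :: "nat \<Rightarrow> triple \<times> nat \<Rightarrow> triple \<times> nat" where
  "mlq_step n ((x\<^sub>1, x\<^sub>2, x\<^sub>3), s) =
     (let t = ring_above n x\<^sub>3 s; u = ring_above n x\<^sub>2 t
      in ((hop n u x\<^sub>1, hop n t x\<^sub>2, hop n s x\<^sub>3), ring_above n x\<^sub>1 u))"

text \<open>Injectivity is read off from the top: the exit site and the new top row determine the
  old top row and the ring that entered it, and so on downwards. Finiteness does the rest.\<close>

lemma mlq_step_bij:
  assumes n: "3 \<le> n"
  shows "bij_betw (mlq_step n) (triples n a b c \<times> {1..n}) (triples n a b c \<times> {1..n})"
proof -
  let ?M = "triples n a b c \<times> {1..n}"
  have fin: "finite ?M" using finite_triples by auto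
  have into: "mlq_step n ` ?M \<subseteq> ?M"
  proof (rule image_subsetI)
    fix r assume r: "r \<in> ?M"
    obtain x1 x2 x3 s where rs: "r = ((x1, x2, x3), s)" by (metis surj_pair)
    show "mlq_step n r \<in> ?M"
      using r hop_in_subsets ring_above_in unfolding rs triples_def by (auto simp: Let_def)
  qed
  have inj: "inj_on (mlq_step n) ?M"
  proof (rule inj_onI)
    fix r r' assume r: "r \<in> ?M" "r' \<in> ?M" and eq: "mlq_step n r = mlq_step n r'"
    obtain x1 x2 x3 s where rs: "r = ((x1, x2, x3), s)" by (metis surj_pair)
    obtain y1 y2 y3 s' where rs': "r' = ((y1, y2, y3), s')" by (metis surj_pair)
    define t u t' u' where "t = ring_above n x3 s" and "u = ring_above n x2 t"
      and "t' = ring_above n y3 s'" and "u' = ring_above n y2 t'"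
    have in1: "s \<in> {1..n}" "s' \<in> {1..n}" using r by (auto simp: rs rs')
    then have in2: "t \<in> {1..n}" "t' \<in> {1..n}" using ring_above_in by (auto simp: t_def t'_def)
    then have in3: "u \<in> {1..n}" "u' \<in> {1..n}" using ring_above_in by (auto simp: u_def u'_def)
    have "hop n u x1 = hop n u' y1" "hop n t x2 = hop n t' y2" "hop n s x3 = hop n s' y3"
      "ring_above n x1 u = ring_above n y1 u'"
      using eq by (auto simp: rs rs' t_def u_def t'_def u'_def Let_def)
    then have "x1 = y1 \<and> u = u'" "hop n t x2 = hop n t' y2" "hop n s x3 = hop n s' y3"
      using hop_ring_above_inj[OF n in3] by auto
    then have "x1 = y1" "x2 = y2 \<and> t = t'" "hop n s x3 = hop n s' y3"
      using hop_ring_above_inj[OF n in2] by (auto simp: u_def u'_def)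
    then show "r = r'"
      using hop_ring_above_inj[OF n in1] by (auto simp: rs rs' t_def t'_def)
  qed
  show ?thesis
    using inj into endo_inj_surj[OF fin into inj] by (auto simp: bij_betw_def)
qed

lemma triples_queues:
  assumes r: "(x1, x2, x3) \<in> triples n a b c" and n: "0 < n" and le: "a \<le> b" "b \<le> c"
  shows "\<exists>q. ring_queue n x1 x2 q" "\<exists>q. ring_queue n x2 x3 q"
    "\<exists>q. ring_queue n (departures n x1 x2) x3 q"
proof -
  have sub: "x1 \<subseteq> {1..n}" "x2 \<subseteq> {1..n}" "x3 \<subseteq> {1..n}" and
    card: "card x1 = a" "card x2 = b" "card x3 = c"
    using r by (auto simp: triples_def)
  show q: "\<exists>q. ring_queue n x1 x2 q"
    by (rule ring_queue_exists) (use sub card le n in auto)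
  show "\<exists>q. ring_queue n x2 x3 q"
    by (rule ring_queue_exists) (use sub card le n in auto)
  have "card (departures n x1 x2) = a" using q card_departures[OF sub(1)] card by blast
  then show "\<exists>q. ring_queue n (departures n x1 x2) x3 q"
    by (intro ring_queue_exists departures_subset) (use sub le card n in auto)
qed

lemma mlq_output_in:
  assumes r: "r \<in> triples n a b c" and n: "0 < n" and le: "a \<le> b" "b \<le> c"
  shows "mlq_output n r \<in> triples n a b c"
proof -
  obtain x1 x2 x3 where rx: "r = (x1, x2, x3)" by (metis surj_pair)
  have sub: "x1 \<subseteq> {1..n}" "x2 \<subseteq> {1..n}" "x3 \<subseteq> {1..n}" and
    card: "card x1 = a" "card x2 = b" "card x3 = c"
    using r by (auto simp: triples_def rx)
  note qs = triples_queues[OF r[unfolded rx] n le]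
  have "card (departures n x1 x2) = a" using qs(1) card_departures[OF sub(1)] card by blast
  moreover have "card (departures n x2 x3) = b" using qs(2) card_departures[OF sub(2)] card by blast
  moreover have "card (departures n (departures n x1 x2) x3) = card (departures n x1 x2)"
    using qs(3) card_departures[OF departures_subset(2)] by blast
  ultimately show ?thesis using sub card departures_subset(2) by (simp add: rx triples_def)
qed

text \<open>The departures from \<open>x2\<close> hop at \<open>ring_above n x3 s\<close>, which is
  exactly the ring that a row above \<open>x3\<close> must receive. So the commutation can be
  applied to the second queue as well.\<close>

lemma mlq_output_step:
  assumes r: "r \<in> triples n a b c" and n: "3 \<le> n" and le: "a \<le> b" "b \<le> c" and s: "s \<in> {1..n}"
  shows "mlq_output n (fst (mlq_step n (r, s))) = hop3 n s (mlq_output n r)"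
proof -
  obtain x1 x2 x3 where rx: "r = (x1, x2, x3)" by (metis surj_pair)
  have "0 < n" using n by simp
  obtain q1 q2 q3 where q: "ring_queue n x1 x2 q1" "ring_queue n x2 x3 q2"
    "ring_queue n (departures n x1 x2) x3 q3"
    using triples_queues[OF r[unfolded rx] \<open>0 < n\<close> le] by blast
  show ?thesis
    using departures_hop[OF n q(1)] departures_hop[OF n q(2) s] departures_hop[OF n q(3) s]
      ring_above_in[OF s]
    by (simp add: rx Let_def)
qed

text \<open>A uniform choice of rows and site is preserved by the bijection \<open>mlq_step\<close>,
  so hopping the output at a uniform site reproduces the law of the output. The law is left
  unnormalised, as the size of each fibre.\<close>

lemma mlq_invariant:
  assumes n: "3 \<le> n" and le: "a \<le> b" "b \<le> c"
  defines "R \<equiv> triples n a b c"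
  shows "(\<Sum>s\<in>{1..n}. \<Sum>x\<in>R. of_bool (hop3 n s x = y) * real (card {r \<in> R. mlq_output n r = x}))
    = real (card {1..n}) * real (card {r \<in> R. mlq_output n r = y})"
proof -
  have fin: "finite R" unfolding R_def by (rule finite_triples)
  have card: "real (card {r \<in> R. mlq_output n r = x}) = (\<Sum>r\<in>R. of_bool (mlq_output n r = x))" for x
    using fin by (simp add: Int_def)
  have "(\<Sum>s\<in>{1..n}. \<Sum>x\<in>R. of_bool (hop3 n s x = y) * real (card {r \<in> R. mlq_output n r = x}))
     = (\<Sum>s\<in>{1..n}. \<Sum>r\<in>R. of_bool (hop3 n s (mlq_output n r) = y))"
  proof (rule sum.cong)
    fix s assume "s \<in> {1..n}"
    have "(\<Sum>x\<in>R. of_bool (hop3 n s x = y) * real (card {r \<in> R. mlq_output n r = x}))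
        = (\<Sum>r\<in>R. \<Sum>x\<in>R. of_bool (hop3 n s x = y) * of_bool (mlq_output n r = x))"
      unfolding card sum_distrib_left by (rule sum.swap)
    also have "\<dots> = (\<Sum>r\<in>R. of_bool (hop3 n s (mlq_output n r) = y))"
    proof (rule sum.cong)
      fix r assume "r \<in> R"
      then have "mlq_output n r \<in> R" unfolding R_def using mlq_output_in le n by auto
      have "(\<Sum>x\<in>R. of_bool (hop3 n s x = y) * of_bool (mlq_output n r = x) :: real)
          = (\<Sum>x\<in>R. if x = mlq_output n r then of_bool (hop3 n s (mlq_output n r) = y) else 0)"
        by (rule sum.cong) auto
      then show "(\<Sum>x\<in>R. of_bool (hop3 n s x = y) * of_bool (mlq_output n r = x) :: real)
          = of_bool (hop3 n s (mlq_output n r) = y)"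
        using fin \<open>mlq_output n r \<in> R\<close> by simp
    qed simp
    finally show "(\<Sum>x\<in>R. of_bool (hop3 n s x = y) * real (card {r \<in> R. mlq_output n r = x}))
        = (\<Sum>r\<in>R. of_bool (hop3 n s (mlq_output n r) = y))" .
  qed simp
  also have "\<dots> = (\<Sum>(r, s)\<in>R \<times> {1..n}. of_bool (hop3 n s (mlq_output n r) = y))"
    by (subst sum.swap) (simp only: sum.cartesian_product)
  also have "\<dots> = (\<Sum>p\<in>R \<times> {1..n}. of_bool (mlq_output n (fst (mlq_step n p)) = y))"
    by (rule sum.cong) (use mlq_output_step n le in \<open>auto simp: R_def\<close>)
  also have "\<dots> = (\<Sum>p\<in>R \<times> {1..n}. of_bool (mlq_output n (fst p) = y))"
    unfolding R_def
    by (rule sum.reindex_bij_betw[OF mlq_step_bij[OF n],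
          where g = "\<lambda>p. of_bool (mlq_output n (fst p) = y)"])
  also have "\<dots> = (\<Sum>r\<in>R. \<Sum>s\<in>{1..n}. of_bool (mlq_output n r = y))"
    by (simp only: sum.cartesian_product split_def)
  also have "\<dots> = real (card {1..n}) * real (card {r \<in> R. mlq_output n r = y})"
    by (simp add: card sum_distrib_left)
  finally show ?thesis .
qed

lemma mlq_total:
  assumes n: "3 \<le> n" and le: "a \<le> b" "b \<le> c"
  shows "(\<Sum>x\<in>triples n a b c. real (card {r \<in> triples n a b c. mlq_output n r = x}))
    = real (card (triples n a b c))"
proof -
  have "mlq_output n ` triples n a b c \<subseteq> triples n a b c" using mlq_output_in le n by auto
  then have "(\<Sum>x\<in>triples n a b c. \<Sum>r\<in>{r \<in> triples n a b c. mlq_output n r = x}. (1::real))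
      = (\<Sum>r\<in>triples n a b c. 1)"
    by (rule sum.group[OF finite_triples finite_triples])
  then show ?thesis by simp
qed

subsection \<open>Projecting the stationary distribution\<close>

definition sites_below :: "nat \<Rightarrow> nat \<Rightarrow> (nat \<Rightarrow> nat) \<Rightarrow> nat set" where
  "sites_below n a w = {x \<in> {1..n}. w x \<le> a}"

definition threshold :: "nat \<Rightarrow> nat \<Rightarrow> nat \<Rightarrow> nat \<Rightarrow> (nat \<Rightarrow> nat) \<Rightarrow> triple" where
  "threshold n a b c w = (sites_below n a w, sites_below n b w, sites_below n c w)"

lemma card_sites_below:
  assumes w: "w permutes {1..n}" and a: "a \<le> n"
  shows "card (sites_below n a w) = a"
proof -
  have "w ` sites_below n a w = {1..a}"
  proof
    show "w ` sites_below n a w \<subseteq> {1..a}"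
      using permutes_in_image[OF w] by (fastforce simp: sites_below_def)
    show "{1..a} \<subseteq> w ` sites_below n a w"
    proof
      fix y assume y: "y \<in> {1..a}"
      then have "y \<in> w ` {1..n}" using permutes_image[OF w] a by auto
      then show "y \<in> w ` sites_below n a w" using y by (auto simp: sites_below_def)
    qed
  qed
  then have "card (w ` sites_below n a w) = a" by simp
  moreover have "inj_on w (sites_below n a w)" using permutes_inj[OF w] inj_on_subset by blast
  ultimately show ?thesis by (simp add: card_image)
qed

lemma threshold_in:
  "w permutes {1..n} \<Longrightarrow> a \<le> n \<Longrightarrow> b \<le> n \<Longrightarrow> c \<le> n \<Longrightarrow> threshold n a b c w \<in> triples n a b c"
  using card_sites_below by (auto simp: threshold_def triples_def sites_below_def)

lemma tasep_ring_permutes: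
  assumes w: "w permutes {1..n}" and s: "s \<in> {1..n}"
  shows "tasep_ring n s w permutes {1..n}"
proof (cases "w (left_site n s) > w s")
  case True
  then have "tasep_ring n s w = w \<circ> Transposition.transpose (left_site n s) s"
    by (auto simp: tasep_ring_def Transposition.transpose_def fun_eq_iff)
  then show ?thesis
    using permutes_compose[OF permutes_swap_id w] left_site_in[OF s] s by metis
qed (use w in \<open>simp add: tasep_ring_def\<close>)

text \<open>An exchange is visible at threshold \<open>a\<close> exactly when \<open>a\<close>
  separates the two species, which is the condition in \<open>hop\<close>. Thus one ring drives all
  thresholds.\<close>

lemma sites_below_tasep_ring:
  assumes n: "3 \<le> n" and s: "s \<in> {1..n}"
  shows "sites_below n a (tasep_ring n s w) = hop n s (sites_below n a w)"
proof (rule set_eqI)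
  fix t
  show "t \<in> sites_below n a (tasep_ring n s w) \<longleftrightarrow> t \<in> hop n s (sites_below n a w)"
    unfolding hop_iff[OF left_site_neq[OF n s]]
    using left_site_in[OF s] s left_site_neq[OF n s]
    by (auto simp: sites_below_def tasep_ring_def)
qed

lemma threshold_tasep_ring:
  "3 \<le> n \<Longrightarrow> s \<in> {1..n} \<Longrightarrow>
    threshold n a b c (tasep_ring n s w) = hop3 n s (threshold n a b c w)"
  by (simp add: threshold_def sites_below_tasep_ring)

text \<open>Uniformisation: counting idle rings too adds the same amount to the inflow and to the
  outflow, so the generator is \<open>N\<close> minus \<open>n\<close> times the identity.
  Stationarity becomes invariance under a ring at a uniform site.\<close>

lemma stationary_balance:
  assumes st: "tasep_stationary n \<pi>" and w': "w' permutes {1..n}"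
  shows "(\<Sum>w | w permutes {1..n}. \<Sum>s\<in>{1..n}. of_bool (tasep_ring n s w = w') * pmf \<pi> w)
    = real n * pmf \<pi> w'"
proof -
  let ?P = "{w. w permutes {1..n}}"
  define N where "N w v = (\<Sum>s\<in>{1..n}. of_bool (tasep_ring n s w = v) :: real)" for w v
  have fin: "finite ?P" by (rule finite_permutations) simp
  have rate: "tasep_rate n w v = (if v = w then 0 else N w v)" for w v
    by (simp add: tasep_rate_def N_def Int_def)
  have total: "(\<Sum>v\<in>?P. N w v) = real n" if "w \<in> ?P" for w
  proof -
    have "(\<Sum>v\<in>?P. N w v) = (\<Sum>s\<in>{1..n}. \<Sum>v\<in>?P. of_bool (tasep_ring n s w = v))"
      unfolding N_def by (rule sum.swap)
    also have "\<dots> = (\<Sum>s\<in>{1..n}. 1)"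
    proof (rule sum.cong)
      fix s assume "s \<in> {1..n}"
      then have "tasep_ring n s w \<in> ?P" using tasep_ring_permutes that by simp
      moreover have "?P \<inter> {v. tasep_ring n s w = v} = (if tasep_ring n s w \<in> ?P then {tasep_ring n s w} else {})"
        by auto
      ultimately show "(\<Sum>v\<in>?P. of_bool (tasep_ring n s w = v)) = (1 :: real)" using fin by simp
    qed simp
    finally show ?thesis by simp
  qed
  have gen: "tasep_generator n w w' = N w w' - (if w' = w then real n else 0)" if "w \<in> ?P" for w
  proof (cases "w' = w")
    case True
    have "(\<Sum>v\<in>?P. tasep_rate n w v) = (\<Sum>v\<in>?P. N w v - (if v = w then N w w else 0))"
      by (rule sum.cong) (auto simp: rate)
    also have "\<dots> = real n - N w w" unfolding sum_subtractf total[OF that] using that fin by simp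
    finally show ?thesis using True by (simp add: tasep_generator_def)
  qed (simp add: tasep_generator_def rate)
  have "0 = (\<Sum>w\<in>?P. pmf \<pi> w * tasep_generator n w w')"
    using st w' by (simp add: tasep_stationary_def)
  also have "\<dots> = (\<Sum>w\<in>?P. pmf \<pi> w * N w w' - (if w = w' then real n * pmf \<pi> w' else 0))"
    by (rule sum.cong) (auto simp: gen algebra_simps)
  also have "\<dots> = (\<Sum>w\<in>?P. pmf \<pi> w * N w w') - real n * pmf \<pi> w'"
    using w' fin by (simp add: sum_subtractf)
  finally show ?thesis by (simp add: N_def sum_distrib_left mult.commute)
qed

lemma sum_threshold:
  fixes f :: "triple \<Rightarrow> real"
  assumes "a \<le> n" "b \<le> n" "c \<le> n"
  shows "(\<Sum>x\<in>triples n a b c. f x * (\<Sum>w | w permutes {1..n}. of_bool (threshold n a b c w = x) * p w))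
    = (\<Sum>w | w permutes {1..n}. f (threshold n a b c w) * p w)"
proof -
  let ?P = "{w. w permutes {1..n}}" and ?R = "triples n a b c"
  have "(\<Sum>x\<in>?R. f x * (\<Sum>w\<in>?P. of_bool (threshold n a b c w = x) * p w))
      = (\<Sum>w\<in>?P. \<Sum>x\<in>?R. f x * (of_bool (threshold n a b c w = x) * p w))"
    unfolding sum_distrib_left by (rule sum.swap)
  also have "\<dots> = (\<Sum>w\<in>?P. f (threshold n a b c w) * p w)"
  proof (rule sum.cong)
    fix w assume "w \<in> ?P"
    then have "threshold n a b c w \<in> ?R" using threshold_in assms by simp
    moreover have "(\<Sum>x\<in>?R. f x * (of_bool (threshold n a b c w = x) * p w)) =
        (\<Sum>x\<in>?R. if x = threshold n a b c w then f (threshold n a b c w) * p w else 0)"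
      by (rule sum.cong) auto
    ultimately show "(\<Sum>x\<in>?R. f x * (of_bool (threshold n a b c w = x) * p w))
        = f (threshold n a b c w) * p w"
      using finite_triples by simp
  qed simp
  finally show ?thesis .
qed

lemma threshold_invariant:
  assumes n: "3 \<le> n" and st: "tasep_stationary n \<pi>" and le: "a \<le> n" "b \<le> n" "c \<le> n"
  defines "\<mu> \<equiv> \<lambda>x. \<Sum>w | w permutes {1..n}. of_bool (threshold n a b c w = x) * pmf \<pi> w"
  shows "(\<Sum>s\<in>{1..n}. \<Sum>x\<in>triples n a b c. of_bool (hop3 n s x = y) * \<mu> x)
    = real (card {1..n}) * \<mu> y"
proof -
  let ?P = "{w. w permutes {1..n}}"
  have fin: "finite ?P" by (rule finite_permutations) simp
  have "(\<Sum>s\<in>{1..n}. \<Sum>x\<in>triples n a b c. of_bool (hop3 n s x = y) * \<mu> x)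
      = (\<Sum>s\<in>{1..n}. \<Sum>w\<in>?P. of_bool (threshold n a b c (tasep_ring n s w) = y) * pmf \<pi> w)"
    unfolding \<mu>_def sum_threshold[OF le] by (rule sum.cong) (simp_all add: threshold_tasep_ring[OF n])
  also have "\<dots> = (\<Sum>s\<in>{1..n}. \<Sum>w\<in>?P. \<Sum>v\<in>?P.
      of_bool (threshold n a b c v = y) * (of_bool (tasep_ring n s w = v) * pmf \<pi> w))"
  proof (intro sum.cong refl)
    fix s w assume "s \<in> {1..n}" "w \<in> ?P"
    then have in_P: "tasep_ring n s w \<in> ?P" using tasep_ring_permutes by simp
    have "(\<Sum>v\<in>?P. of_bool (threshold n a b c v = y) * (of_bool (tasep_ring n s w = v) * pmf \<pi> w))
        = (\<Sum>v\<in>?P. if v = tasep_ring n s w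
            then of_bool (threshold n a b c (tasep_ring n s w) = y) * pmf \<pi> w else 0)"
      by (rule sum.cong) auto
    then show "of_bool (threshold n a b c (tasep_ring n s w) = y) * pmf \<pi> w = (\<Sum>v\<in>?P.
        of_bool (threshold n a b c v = y) * (of_bool (tasep_ring n s w = v) * pmf \<pi> w))"
      using in_P fin by simp
  qed
  also have "\<dots> = (\<Sum>w\<in>?P. \<Sum>s\<in>{1..n}. \<Sum>v\<in>?P.
      of_bool (threshold n a b c v = y) * (of_bool (tasep_ring n s w = v) * pmf \<pi> w))"
    by (rule sum.swap)
  also have "\<dots> = (\<Sum>w\<in>?P. \<Sum>v\<in>?P. \<Sum>s\<in>{1..n}.
      of_bool (threshold n a b c v = y) * (of_bool (tasep_ring n s w = v) * pmf \<pi> w))"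
    by (rule sum.cong[OF refl], rule sum.swap)
  also have "\<dots> = (\<Sum>v\<in>?P. \<Sum>w\<in>?P. \<Sum>s\<in>{1..n}.
      of_bool (threshold n a b c v = y) * (of_bool (tasep_ring n s w = v) * pmf \<pi> w))"
    by (rule sum.swap)
  also have "\<dots> = (\<Sum>v\<in>?P. of_bool (threshold n a b c v = y) * (real n * pmf \<pi> v))"
    by (rule sum.cong) (simp_all only: sum_distrib_left[symmetric] mem_Collect_eq stationary_balance[OF st])
  also have "\<dots> = real (card {1..n}) * \<mu> y"
    by (simp add: \<mu>_def sum_distrib_left mult.left_commute)
  finally show ?thesis .
qed

lemma measure_stationary:
  assumes "tasep_stationary n \<pi>"
  shows "measure_pmf.prob \<pi> {w. V w} = (\<Sum>w | w permutes {1..n}. of_bool (V w) * pmf \<pi> w)"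
proof -
  let ?P = "{w. w permutes {1..n}}"
  have fin: "finite ?P" by (rule finite_permutations) simp
  have sub: "set_pmf \<pi> \<subseteq> ?P" using assms by (simp add: tasep_stationary_def)
  have "measure_pmf.prob \<pi> {w. V w} = measure_pmf.prob \<pi> ({w. V w} \<inter> ?P)"
    using sub by (intro measure_prob_cong_0) (auto simp: set_pmf_iff)
  also have "\<dots> = (\<Sum>w\<in>?P \<inter> {w. V w}. pmf \<pi> w)"
    using fin by (simp add: measure_measure_pmf_finite Int_commute)
  also have "\<dots> = (\<Sum>w\<in>?P. of_bool (V w) * pmf \<pi> w)"
    using fin by (intro sum.mono_neutral_cong_left) auto
  finally show ?thesis .
qed

text \<open>The projected law and the normalised fibre sizes are both invariant of mass 1; their
  difference has total 0 and vanishes by uniqueness.\<close>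

theorem prob_threshold_mlq:
  assumes n: "3 \<le> n" and st: "tasep_stationary n \<pi>" and le: "a \<le> b" "b \<le> c" "c \<le> n"
  shows "measure_pmf.prob \<pi> {w. V (threshold n a b c w)} =
    real (card {r \<in> triples n a b c. V (mlq_output n r)})
      / (real (n choose a) * real (n choose b) * real (n choose c))"
proof -
  let ?P = "{w. w permutes {1..n}}" and ?R = "triples n a b c"
  have le': "a \<le> n" "b \<le> n" "c \<le> n" using le by auto
  define K where "K = real (card ?R)"
  have K: "K = real (n choose a) * real (n choose b) * real (n choose c)"
    by (simp add: K_def card_triples)
  then have "K > 0" using le' by (simp add: zero_less_binomial)
  define \<mu> where "\<mu> = (\<lambda>x. \<Sum>w\<in>?P. of_bool (threshold n a b c w = x) * pmf \<pi> w)"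
  define \<nu> where "\<nu> = (\<lambda>x. real (card {r \<in> ?R. mlq_output n r = x}))"
  have "(\<Sum>x\<in>?R. \<mu> x) = (\<Sum>w\<in>?P. pmf \<pi> w)"
    using sum_threshold[OF le', of "\<lambda>_. 1" "pmf \<pi>"] by (simp add: \<mu>_def)
  also have "\<dots> = 1" using measure_stationary[OF st, of "\<lambda>_. True"] by simp
  finally have sum\<mu>: "(\<Sum>x\<in>?R. \<mu> x) = 1" .
  have sum\<nu>: "(\<Sum>x\<in>?R. \<nu> x) = K" using mlq_total[OF n le(1,2)] by (simp add: \<nu>_def K_def)
  have eq: "\<mu> x - \<nu> x / K = 0" if "x \<in> ?R" for x
  proof (rule invariant_unique[where T = "hop3 n" and I = "{1..n}" and \<Omega> = ?R
        and z = "({1..a}, {1..b}, {1..c})" and d = "\<lambda>x. \<mu> x - \<nu> x / K"])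
    show "finite ?R" by (rule finite_triples)
    show "hop3 n s x \<in> ?R" if "s \<in> {1..n}" "x \<in> ?R" for s x using hop3_in that .
    show "(\<Sum>s\<in>{1..n}. \<Sum>x\<in>?R. of_bool (hop3 n s x = y) * (\<mu> x - \<nu> x / K))
        = real (card {1..n}) * (\<mu> y - \<nu> y / K)" for y
    proof -
      have "(\<Sum>s\<in>{1..n}. \<Sum>x\<in>?R. of_bool (hop3 n s x = y) * (\<mu> x - \<nu> x / K))
          = (\<Sum>s\<in>{1..n}. \<Sum>x\<in>?R. of_bool (hop3 n s x = y) * \<mu> x)
            - (\<Sum>s\<in>{1..n}. \<Sum>x\<in>?R. of_bool (hop3 n s x = y) * \<nu> x) / K"
        by (simp only: right_diff_distrib sum_subtractf sum_divide_distrib times_divide_eq_right)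
      also have "\<dots> = real (card {1..n}) * \<mu> y - real (card {1..n}) * \<nu> y / K"
        using threshold_invariant[OF n st le', of y] mlq_invariant[OF n le(1,2), of y]
        unfolding \<mu>_def \<nu>_def by (simp only:)
      finally show ?thesis by (simp only: right_diff_distrib times_divide_eq_right)
    qed
    show "(\<Sum>x\<in>?R. \<mu> x - \<nu> x / K) = 0"
      using sum\<mu> sum\<nu> \<open>K > 0\<close> by (simp add: sum_subtractf sum_divide_distrib[symmetric])
    show "({1..a}, {1..b}, {1..c}) \<in> C"
      if "C \<subseteq> ?R" "C \<noteq> {}" "\<And>s x. s \<in> {1..n} \<Longrightarrow> x \<in> C \<Longrightarrow> hop3 n s x \<in> C" for C
      using sorted_reachable that .
  qed (use that in auto)
  have "measure_pmf.prob \<pi> {w. V (threshold n a b c w)} = (\<Sum>x\<in>?R. of_bool (V x) * \<mu> x)"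
    unfolding measure_stationary[OF st] \<mu>_def by (rule sum_threshold[OF le', symmetric])
  also have "\<dots> = (\<Sum>x\<in>?R. of_bool (V x) * \<nu> x) / K"
    unfolding sum_divide_distrib by (rule sum.cong) (use eq in auto)
  also have "(\<Sum>x\<in>?R. of_bool (V x) * \<nu> x) = real (card {r \<in> ?R. V (mlq_output n r)})"
  proof -
    have "mlq_output n ` {r \<in> ?R. V (mlq_output n r)} \<subseteq> ?R"
      using mlq_output_in le n by auto
    then have "(\<Sum>x\<in>?R. \<Sum>r\<in>{r \<in> {r \<in> ?R. V (mlq_output n r)}. mlq_output n r = x}. (1::real))
        = (\<Sum>r\<in>{r \<in> ?R. V (mlq_output n r)}. 1)"
      using finite_triples by (intro sum.group) auto
    moreover have "(\<Sum>r\<in>{r \<in> {r \<in> ?R. V (mlq_output n r)}. mlq_output n r = x}. (1::real))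
        = of_bool (V x) * \<nu> x" for x
    proof (cases "V x")
      case True
      then have "{r \<in> {r \<in> ?R. V (mlq_output n r)}. mlq_output n r = x} = {r \<in> ?R. mlq_output n r = x}"
        by auto
      then show ?thesis using True by (simp add: \<nu>_def)
    next
      case False
      then have "{r \<in> {r \<in> ?R. V (mlq_output n r)}. mlq_output n r = x} = {}" by auto
      then show ?thesis using False by (simp only:) simp
    qed
    ultimately show ?thesis by simp
  qed
  finally show ?thesis by (simp add: K)
qed

subsection \<open>Counting dominated rows\<close>

text \<open>The bound \<open>t\<close> leaves the sites below it free, so that their contents can be
  prescribed separately.\<close>

definition dominated :: "nat \<Rightarrow> nat \<Rightarrow> nat set \<Rightarrow> nat set \<Rightarrow> bool" where
  "dominated t n x y \<longleftrightarrow> (\<forall>u\<ge>t. card (x \<inter> {u..n}) \<le> card (y \<inter> {u..n}))"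

lemma card_Int_atLeastAtMost_Suc:
  assumes "u \<le> n"
  shows "card (x \<inter> {u..n}) = of_bool (u \<in> x) + card (x \<inter> {Suc u..n})"
proof -
  have "x \<inter> {u..n} = (if u \<in> x then insert u (x \<inter> {Suc u..n}) else x \<inter> {Suc u..n})"
    using assms by (auto simp: Suc_le_eq le_less)
  then show ?thesis by simp
qed

text \<open>If nobody waits at \<open>n\<close>, the arrivals in a final segment were served inside
  it. Conversely, no service is lost after the last zero, so the load at \<open>n\<close> is the
  excess of arrivals over services from there on, which domination excludes.\<close>

lemma queue_empty_iff_dominated:
  assumes q: "ring_queue n A S q" and n: "1 \<le> n" and A: "A \<subseteq> {1..n}" and S: "S \<subseteq> {1..n}"
  shows "q n = 0 \<longleftrightarrow> dominated 0 n A S"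
proof
  \<comment> \<open>Site 0 is a copy of site \<open>n\<close>; this cuts the ring open.\<close>
  define q0 where "q0 u = (if u = 0 then q n else q u)" for u
  have rec: "q0 (Suc u) = q0 u + of_bool (Suc u \<in> A) - of_bool (Suc u \<in> S)" if "u < n" for u
  proof -
    have "q (Suc u) = q (left_site n (Suc u)) + of_bool (Suc u \<in> A) - of_bool (Suc u \<in> S)"
      using q that by (simp add: ring_queue_def)
    moreover have "q (left_site n (Suc u)) = q0 u" "q0 (Suc u) = q (Suc u)"
      by (simp_all add: left_site_def q0_def)
    ultimately show ?thesis by simp
  qed
  have q0n: "q0 n = q n" using n by (simp add: q0_def)
  {
    assume 0: "q n = 0"
    have le: "q0 u + card (A \<inter> {Suc u..n}) \<le> q0 n + card (S \<inter> {Suc u..n})" if "u \<le> n" for u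
      using that
    proof (induction rule: inc_induct)
      case (step u)
      have "card (A \<inter> {Suc u..n}) = of_bool (Suc u \<in> A) + card (A \<inter> {Suc (Suc u)..n})"
        "card (S \<inter> {Suc u..n}) = of_bool (Suc u \<in> S) + card (S \<inter> {Suc (Suc u)..n})"
        by (rule card_Int_atLeastAtMost_Suc, use step in simp)+
      then show ?case using step.IH rec[OF step.hyps(2)] by (simp split: if_splits)
    qed simp
    have "card (A \<inter> {u..n}) \<le> card (S \<inter> {u..n})" for u
    proof -
      have "card (A \<inter> {Suc v..n}) \<le> card (S \<inter> {Suc v..n})" for v
        using le[of v] 0 q0n by (cases "v \<le> n") auto
      moreover have "A \<inter> {0..n} = A \<inter> {Suc 0..n}" "S \<inter> {0..n} = S \<inter> {Suc 0..n}"
        using A S by auto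
      ultimately show ?thesis by (cases u) (metis, blast)
    qed
    then show "dominated 0 n A S" by (simp add: dominated_def)
  }
  assume dom: "dominated 0 n A S"
  obtain t where t: "t \<le> n" "q0 t = 0" using q by (auto simp: ring_queue_def q0_def)
  define t0 where "t0 = (GREATEST u. u \<le> n \<and> q0 u = 0)"
  have t0: "t0 \<le> n" "q0 t0 = 0"
    using GreatestI_nat[of "\<lambda>u. u \<le> n \<and> q0 u = 0" t n] t by (auto simp: t0_def)
  have pos: "0 < q0 u" if "t0 < u" "u \<le> n" for u
    using Greatest_le_nat[of "\<lambda>u. u \<le> n \<and> q0 u = 0" u n] that by (fastforce simp: t0_def)
  have eq: "q0 t0 + card (A \<inter> {Suc t0..n}) = q0 n + card (S \<inter> {Suc t0..n})"
    using t0(1)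
  proof (induction rule: inc_induct)
    case base
    then show ?case by simp
  next
    case (step u)
    have "card (A \<inter> {Suc u..n}) = of_bool (Suc u \<in> A) + card (A \<inter> {Suc (Suc u)..n})"
      "card (S \<inter> {Suc u..n}) = of_bool (Suc u \<in> S) + card (S \<inter> {Suc (Suc u)..n})"
      by (rule card_Int_atLeastAtMost_Suc, use step in simp)+
    moreover have "0 < q0 (Suc u)" using pos step by simp
    ultimately show ?case using step.IH rec[OF step.hyps(2)] by (simp split: if_splits)
  qed
  have "card (A \<inter> {Suc t0..n}) \<le> card (S \<inter> {Suc t0..n})" using dom by (simp add: dominated_def)
  then show "q n = 0" using eq t0 q0n by simp
qed

text \<open>Sizes are integers so that the recursion may subtract from size 0 and reach an empty
  set. For \<open>t > 0\<close> the pattern also fixes site 0.\<close>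

definition pattern_rows ::
  "nat \<Rightarrow> nat \<Rightarrow> nat set \<Rightarrow> nat set \<Rightarrow> nat set \<Rightarrow> int \<Rightarrow> int \<Rightarrow> int \<Rightarrow> triple set" where
  "pattern_rows n t p\<^sub>1 p\<^sub>2 p\<^sub>3 \<alpha> \<beta> \<gamma> =
    {(x\<^sub>1, x\<^sub>2, x\<^sub>3). x\<^sub>1 \<subseteq> {..n} \<and> x\<^sub>2 \<subseteq> {..n} \<and> x\<^sub>3 \<subseteq> {..n} \<and>
      x\<^sub>1 \<inter> {..<t} = p\<^sub>1 \<and> x\<^sub>2 \<inter> {..<t} = p\<^sub>2 \<and> x\<^sub>3 \<inter> {..<t} = p\<^sub>3 \<and>
      int (card x\<^sub>1) = \<alpha> \<and> int (card x\<^sub>2) = \<beta> \<and> int (card x\<^sub>3) = \<gamma> \<and>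
      dominated t n x\<^sub>1 x\<^sub>2 \<and> dominated t n x\<^sub>2 x\<^sub>3}"

lemma finite_pattern_rows: "finite (pattern_rows n t p1 p2 p3 \<alpha> \<beta> \<gamma>)"
  by (rule finite_subset[of _ "Pow {..n} \<times> Pow {..n} \<times> Pow {..n}"]) (auto simp: pattern_rows_def)

lemma pattern_rows_pattern:
  "(x1, x2, x3) \<in> pattern_rows n t p1 p2 p3 \<alpha> \<beta> \<gamma> \<Longrightarrow>
    p1 = x1 \<inter> {..<t} \<and> p2 = x2 \<inter> {..<t} \<and> p3 = x3 \<inter> {..<t}"
  by (simp add: pattern_rows_def)

lemma card_pattern_rows:
  assumes p: "p1 \<subseteq> {..<t}" "p2 \<subseteq> {..<t}" "p3 \<subseteq> {..<t}" and t: "t \<le> Suc n"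
  shows "card (pattern_rows n t p1 p2 p3 \<alpha> \<beta> \<gamma>) =
    card (pattern_rows n t {} {} {} (\<alpha> - int (card p1)) (\<beta> - int (card p2)) (\<gamma> - int (card p3)))"
proof -
  have fp: "finite p1" "finite p2" "finite p3" using p by (auto intro: finite_subset)
  have card_split: "card x = card (x \<inter> {..<t}) + card (x - {..<t})" if "x \<subseteq> {..n}" for x
    using that by (metis card_Int_Diff finite_atMost finite_subset)
  have card_Un: "card (p \<union> y) = card p + card y"
    if "p \<subseteq> {..<t}" "y \<inter> {..<t} = {}" "y \<subseteq> {..n}" for p y :: "nat set"
    by (rule card_Un_disjoint) (use that in \<open>auto intro: finite_subset\<close>)
  have tail: "(x - {..<t}) \<inter> {u..n} = x \<inter> {u..n}"
    "p \<subseteq> {..<t} \<Longrightarrow> (p \<union> x) \<inter> {u..n} = x \<inter> {u..n}" if "t \<le> u" for x p u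
    using that by auto
  have dom: "dominated t n (x - {..<t}) (y - {..<t}) \<longleftrightarrow> dominated t n x y"
    "p \<subseteq> {..<t} \<Longrightarrow> p' \<subseteq> {..<t} \<Longrightarrow> dominated t n (p \<union> x) (p' \<union> y) \<longleftrightarrow> dominated t n x y" for x y p p'
    unfolding dominated_def using tail by auto
  have "bij_betw (\<lambda>(x1, x2, x3). (x1 - {..<t}, x2 - {..<t}, x3 - {..<t}))
      (pattern_rows n t p1 p2 p3 \<alpha> \<beta> \<gamma>)
      (pattern_rows n t {} {} {} (\<alpha> - int (card p1)) (\<beta> - int (card p2)) (\<gamma> - int (card p3)))"
  proof (rule bij_betw_byWitness[where f' = "\<lambda>(y1, y2, y3). (p1 \<union> y1, p2 \<union> y2, p3 \<union> y3)"])
    show "\<forall>a\<in>pattern_rows n t p1 p2 p3 \<alpha> \<beta> \<gamma>.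
      (case case a of (x1, x2, x3) \<Rightarrow> (x1 - {..<t}, x2 - {..<t}, x3 - {..<t}) of
        (y1, y2, y3) \<Rightarrow> (p1 \<union> y1, p2 \<union> y2, p3 \<union> y3)) = a"
      by (auto simp: pattern_rows_def)
    show "\<forall>a\<in>pattern_rows n t {} {} {} (\<alpha> - int (card p1)) (\<beta> - int (card p2)) (\<gamma> - int (card p3)).
      (case case a of (y1, y2, y3) \<Rightarrow> (p1 \<union> y1, p2 \<union> y2, p3 \<union> y3) of
        (x1, x2, x3) \<Rightarrow> (x1 - {..<t}, x2 - {..<t}, x3 - {..<t})) = a"
      using p by (auto simp: pattern_rows_def)
    show "(\<lambda>(x1, x2, x3). (x1 - {..<t}, x2 - {..<t}, x3 - {..<t})) ` pattern_rows n t p1 p2 p3 \<alpha> \<beta> \<gamma>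
      \<subseteq> pattern_rows n t {} {} {} (\<alpha> - int (card p1)) (\<beta> - int (card p2)) (\<gamma> - int (card p3))"
    proof (rule image_subsetI)
      fix r assume r: "r \<in> pattern_rows n t p1 p2 p3 \<alpha> \<beta> \<gamma>"
      obtain x1 x2 x3 where rx: "r = (x1, x2, x3)" by (metis surj_pair)
      have sub: "x1 \<subseteq> {..n}" "x2 \<subseteq> {..n}" "x3 \<subseteq> {..n}" using r by (auto simp: rx pattern_rows_def)
      show "(case r of (x1, x2, x3) \<Rightarrow> (x1 - {..<t}, x2 - {..<t}, x3 - {..<t}))
        \<in> pattern_rows n t {} {} {} (\<alpha> - int (card p1)) (\<beta> - int (card p2)) (\<gamma> - int (card p3))"
        using r sub card_split[OF sub(1)] card_split[OF sub(2)] card_split[OF sub(3)]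
        by (auto simp: rx pattern_rows_def dom)
    qed
    show "(\<lambda>(y1, y2, y3). (p1 \<union> y1, p2 \<union> y2, p3 \<union> y3)) `
        pattern_rows n t {} {} {} (\<alpha> - int (card p1)) (\<beta> - int (card p2)) (\<gamma> - int (card p3))
      \<subseteq> pattern_rows n t p1 p2 p3 \<alpha> \<beta> \<gamma>"
    proof (rule image_subsetI)
      fix r assume r: "r \<in> pattern_rows n t {} {} {}
        (\<alpha> - int (card p1)) (\<beta> - int (card p2)) (\<gamma> - int (card p3))"
      obtain y1 y2 y3 where ry: "r = (y1, y2, y3)" by (metis surj_pair)
      have y: "y1 \<inter> {..<t} = {}" "y1 \<subseteq> {..n}" "y2 \<inter> {..<t} = {}" "y2 \<subseteq> {..n}"
        "y3 \<inter> {..<t} = {}" "y3 \<subseteq> {..n}"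
        and dom_y: "dominated t n y1 y2" "dominated t n y2 y3"
        and card_y: "int (card y1) = \<alpha> - int (card p1)" "int (card y2) = \<beta> - int (card p2)"
          "int (card y3) = \<gamma> - int (card p3)"
        using r by (auto simp: ry pattern_rows_def)
      have "p1 \<subseteq> {..n}" "p2 \<subseteq> {..n}" "p3 \<subseteq> {..n}" using p t by force+
      moreover have "(p1 \<union> y1) \<inter> {..<t} = p1" "(p2 \<union> y2) \<inter> {..<t} = p2" "(p3 \<union> y3) \<inter> {..<t} = p3"
        using p y by auto
      ultimately show "(case r of (y1, y2, y3) \<Rightarrow> (p1 \<union> y1, p2 \<union> y2, p3 \<union> y3))
        \<in> pattern_rows n t p1 p2 p3 \<alpha> \<beta> \<gamma>"
        using y dom_y card_y p card_Un by (simp add: ry pattern_rows_def dom)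
    qed
  qed
  then show ?thesis by (rule bij_betw_same_card)
qed

section \<open>The determinant formula for dominated rows\<close>

definition ibinomial :: "nat \<Rightarrow> int \<Rightarrow> int" where
  "ibinomial m k = (if k < 0 then 0 else int (m choose nat k))"

lemma ibinomial_Suc: "ibinomial (Suc m) k = ibinomial m k + ibinomial m (k - 1)"
proof (cases "k \<le> 0")
  case False
  then obtain l where "k = int (Suc l)" by (metis not_le pos_int_cases Suc_pred)
  then show ?thesis by (simp add: ibinomial_def nat_add_distrib)
qed (auto simp: ibinomial_def)

definition det3 :: "'a::comm_ring_1 \<Rightarrow> 'a \<Rightarrow> 'a \<Rightarrow> 'a \<Rightarrow> 'a \<Rightarrow> 'a \<Rightarrow> 'a \<Rightarrow> 'a \<Rightarrow> 'a \<Rightarrow> 'a" where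
  "det3 a b c d e f g h i = a * (e * i - f * h) - b * (d * i - f * g) + c * (d * h - e * g)"

text \<open>The dual Jacobi--Trudi determinant of the partition \<open>(\<gamma>, \<beta>, \<alpha>)\<close> in \<open>m\<close> variables, all equal
  to 1. It vanishes when \<open>\<alpha> = \<beta> + 1\<close> or \<open>\<beta> = \<gamma> + 1\<close>, which makes it satisfy the boundary conditions of
  the recursion for dominated rows.\<close>

definition row_det :: "nat \<Rightarrow> int \<Rightarrow> int \<Rightarrow> int \<Rightarrow> int" where
  "row_det m \<alpha> \<beta> \<gamma> = det3
     (ibinomial m \<gamma>) (ibinomial m (\<gamma> + 1)) (ibinomial m (\<gamma> + 2))
     (ibinomial m (\<beta> - 1)) (ibinomial m \<beta>) (ibinomial m (\<beta> + 1))
     (ibinomial m (\<alpha> - 2)) (ibinomial m (\<alpha> - 1)) (ibinomial m \<alpha>)"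

text \<open>Pascal's rule writes each row of the determinant as itself plus the same row with its
  parameter lowered by 1. Multilinearity gives eight terms, one for each choice of the rows that
  occupy the new site.\<close>

lemma row_det_Suc:
  "row_det (Suc m) \<alpha> \<beta> \<gamma> =
     (row_det m \<alpha> \<beta> \<gamma> + row_det m \<alpha> \<beta> (\<gamma> - 1)) + (row_det m \<alpha> (\<beta> - 1) \<gamma> + row_det m \<alpha> (\<beta> - 1) (\<gamma> - 1))
     + ((row_det m (\<alpha> - 1) \<beta> \<gamma> + row_det m (\<alpha> - 1) \<beta> (\<gamma> - 1))
     + (row_det m (\<alpha> - 1) (\<beta> - 1) \<gamma> + row_det m (\<alpha> - 1) (\<beta> - 1) (\<gamma> - 1)))"
  by (simp add: row_det_def ibinomial_Suc det3_def algebra_simps)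

text \<open>Two rows of the matrix coincide.\<close>

lemma row_det_boundary:
  "row_det m (\<beta> + 1) \<beta> \<gamma> = 0" "row_det m \<alpha> (\<gamma> + 1) \<gamma> = 0"
  by (simp_all add: row_det_def det3_def algebra_simps)

lemma pattern_rows_total:
  assumes "(x1, x2, x3) \<in> pattern_rows n t {} {} {} \<alpha> \<beta> \<gamma>"
  shows "\<alpha> \<le> \<beta>" "\<beta> \<le> \<gamma>"
proof -
  have "x \<inter> {t..n} = x" if "x \<subseteq> {..n}" "x \<inter> {..<t} = {}" for x
    using that by (force simp: not_less)
  then show "\<alpha> \<le> \<beta>" "\<beta> \<le> \<gamma>"
    using assms by (auto simp: pattern_rows_def dominated_def dest!: spec[of _ t])
qed

text \<open>Filling one site can break the order of the sizes by at most 1, and there both sides are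
  0; the hypotheses allow this margin. The same bounds exclude all permutations but the identity
  from the determinant at \<open>t = Suc n\<close>.\<close>

lemma card_dominated_rows:
  assumes "t \<le> Suc n" and "\<alpha> \<le> \<beta> + 1" and "\<beta> \<le> \<gamma> + 1"
  shows "int (card (pattern_rows n t {} {} {} \<alpha> \<beta> \<gamma>)) = row_det (Suc n - t) \<alpha> \<beta> \<gamma>"
  using assms
proof (induction arbitrary: \<alpha> \<beta> \<gamma> rule: inc_induct)
  case base
  have "pattern_rows n (Suc n) {} {} {} \<alpha> \<beta> \<gamma> = (if \<alpha> = 0 \<and> \<beta> = 0 \<and> \<gamma> = 0 then {({}, {}, {})} else {})"
  proof -
    have "x = {}" if "x \<subseteq> {..n}" "x \<inter> {..<Suc n} = {}" for x
      using that by (auto simp: lessThan_Suc_atMost)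
    note empty = this[rotated]
    show ?thesis by (auto simp: pattern_rows_def dominated_def dest!: empty)
  qed
  moreover have "row_det 0 \<alpha> \<beta> \<gamma> = (if \<alpha> = 0 \<and> \<beta> = 0 \<and> \<gamma> = 0 then 1 else 0)"
  proof -
    have "ibinomial 0 k = of_bool (k = 0)" for k by (auto simp: ibinomial_def)
    then show ?thesis using base by (auto simp: row_det_def det3_def)
  qed
  ultimately show ?case by simp
next
  case (step t)
  consider "\<alpha> = \<beta> + 1" | "\<beta> = \<gamma> + 1" | "\<alpha> \<le> \<beta>" "\<beta> \<le> \<gamma>" using step.prems by linarith
  then show ?case
  proof cases
    case 1
    then have "pattern_rows n t {} {} {} \<alpha> \<beta> \<gamma> = {}" using pattern_rows_total by fastforce
    then show ?thesis using 1 row_det_boundary by simp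
  next
    case 2
    then have "pattern_rows n t {} {} {} \<alpha> \<beta> \<gamma> = {}" using pattern_rows_total by fastforce
    then show ?thesis using 2 row_det_boundary by simp
  next
    case 3
    define P where "P = {{}, {t}}"
    have "pattern_rows n t {} {} {} \<alpha> \<beta> \<gamma> =
      (\<Union>p\<in>P \<times> P \<times> P. case p of (p1, p2, p3) \<Rightarrow> pattern_rows n (Suc t) p1 p2 p3 \<alpha> \<beta> \<gamma>)"
      (is "?L = ?R")
    proof -
      have low: "x \<inter> {..<t} = {} \<longleftrightarrow> x \<inter> {..<Suc t} \<in> P" for x
      proof
        assume "x \<inter> {..<t} = {}"
        then have "x \<inter> {..<Suc t} = (if t \<in> x then {t} else {})" by (auto simp: less_Suc_eq)
        then show "x \<inter> {..<Suc t} \<in> P" by (simp add: P_def)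
      next
        assume "x \<inter> {..<Suc t} \<in> P"
        then have "x \<inter> {..<Suc t} \<subseteq> {t}" by (auto simp: P_def)
        then show "x \<inter> {..<t} = {}" by fastforce
      qed
      \<comment> \<open>The inequality at \<open>u = t\<close> compares whole rows, so it is a
        condition on sizes only, which the present case supplies.\<close>
      have dom: "dominated t n x y \<longleftrightarrow> dominated (Suc t) n x y \<and> card x \<le> card y"
        if "x \<subseteq> {..n}" "x \<inter> {..<t} = {}" "y \<subseteq> {..n}" "y \<inter> {..<t} = {}" for x y
      proof -
        have "x \<inter> {t..n} = x" "y \<inter> {t..n} = y" using that by (force simp: not_less)+
        moreover have "(\<forall>u\<ge>t. P u) \<longleftrightarrow> (\<forall>u\<ge>Suc t. P u) \<and> P t" for P
          by (metis Suc_le_eq le_eq_less_or_eq)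
        ultimately show ?thesis unfolding dominated_def by simp
      qed
      have "r \<in> ?L \<longleftrightarrow> r \<in> ?R" for r
      proof -
        obtain x1 x2 x3 where r: "r = (x1, x2, x3)" by (metis surj_pair)
        define C where "C \<longleftrightarrow> x1 \<subseteq> {..n} \<and> x2 \<subseteq> {..n} \<and> x3 \<subseteq> {..n} \<and>
          int (card x1) = \<alpha> \<and> int (card x2) = \<beta> \<and> int (card x3) = \<gamma> \<and>
          dominated (Suc t) n x1 x2 \<and> dominated (Suc t) n x2 x3"
        have "r \<in> pattern_rows n (Suc t) p1 p2 p3 \<alpha> \<beta> \<gamma> \<longleftrightarrow>
            p1 = x1 \<inter> {..<Suc t} \<and> p2 = x2 \<inter> {..<Suc t} \<and> p3 = x3 \<inter> {..<Suc t} \<and> C" for p1 p2 p3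
          unfolding r pattern_rows_def C_def mem_Collect_eq prod.case by argo
        then have "r \<in> ?R \<longleftrightarrow>
            (x1 \<inter> {..<Suc t} \<in> P \<and> x2 \<inter> {..<Suc t} \<in> P \<and> x3 \<inter> {..<Suc t} \<in> P) \<and> C"
          by auto
        moreover have "r \<in> ?L \<longleftrightarrow>
            (x1 \<inter> {..<t} = {} \<and> x2 \<inter> {..<t} = {} \<and> x3 \<inter> {..<t} = {}) \<and> C"
        proof (cases "x1 \<subseteq> {..n} \<and> x2 \<subseteq> {..n} \<and> x3 \<subseteq> {..n} \<and>
            x1 \<inter> {..<t} = {} \<and> x2 \<inter> {..<t} = {} \<and> x3 \<inter> {..<t} = {} \<and>
            int (card x1) = \<alpha> \<and> int (card x2) = \<beta> \<and> int (card x3) = \<gamma>")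
          case True
          then have "card x1 \<le> card x2" "card x2 \<le> card x3" using 3 by linarith+
          then have "dominated t n x1 x2 \<longleftrightarrow> dominated (Suc t) n x1 x2"
            "dominated t n x2 x3 \<longleftrightarrow> dominated (Suc t) n x2 x3"
            using True dom by blast+
          then show ?thesis
            unfolding r pattern_rows_def C_def mem_Collect_eq prod.case using True by argo
        next
          case False
          then show ?thesis
            unfolding r pattern_rows_def C_def mem_Collect_eq prod.case by argo
        qed
        ultimately show ?thesis unfolding low by blast
      qed
      then show ?thesis by blast
    qed
    also have "card \<dots> = (\<Sum>p\<in>P \<times> P \<times> P.
        card (case p of (p1, p2, p3) \<Rightarrow> pattern_rows n (Suc t) p1 p2 p3 \<alpha> \<beta> \<gamma>))"
    proof (rule card_UN_disjoint)
      show "\<forall>p\<in>P \<times> P \<times> P. \<forall>p'\<in>P \<times> P \<times> P. p \<noteq> p' \<longrightarrow>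
        (case p of (p1, p2, p3) \<Rightarrow> pattern_rows n (Suc t) p1 p2 p3 \<alpha> \<beta> \<gamma>) \<inter>
        (case p' of (p1, p2, p3) \<Rightarrow> pattern_rows n (Suc t) p1 p2 p3 \<alpha> \<beta> \<gamma>) = {}"
      proof (intro ballI impI equals0I)
        fix p p' r assume "p \<noteq> p'"
          "r \<in> (case p of (p1, p2, p3) \<Rightarrow> pattern_rows n (Suc t) p1 p2 p3 \<alpha> \<beta> \<gamma>) \<inter>
            (case p' of (p1, p2, p3) \<Rightarrow> pattern_rows n (Suc t) p1 p2 p3 \<alpha> \<beta> \<gamma>)"
        then show False
          by (cases p, cases p', cases r) (auto dest!: pattern_rows_pattern)
      qed
    qed (auto simp: finite_pattern_rows P_def)
    also have "\<dots> = (\<Sum>p1\<in>P. \<Sum>p2\<in>P. \<Sum>p3\<in>P. card (pattern_rows n (Suc t) p1 p2 p3 \<alpha> \<beta> \<gamma>))"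
      by (simp only: sum.cartesian_product split_def fst_conv snd_conv)
    also have "\<dots> = (\<Sum>p1\<in>P. \<Sum>p2\<in>P. \<Sum>p3\<in>P. card (pattern_rows n (Suc t) {} {} {}
        (\<alpha> - int (card p1)) (\<beta> - int (card p2)) (\<gamma> - int (card p3))))"
      by (intro sum.cong refl card_pattern_rows) (use step.hyps in \<open>auto simp: P_def\<close>)
    also have "int \<dots> = row_det (Suc n - t) \<alpha> \<beta> \<gamma>"
    proof -
      have "Suc n - t = Suc (Suc n - Suc t)" using step.hyps by simp
      moreover have IH: "int (card (pattern_rows n (Suc t) {} {} {} \<alpha>' \<beta>' \<gamma>')) = row_det (Suc n - Suc t) \<alpha>' \<beta>' \<gamma>'"
        if "\<alpha> - 1 \<le> \<alpha>'" "\<alpha>' \<le> \<alpha>" "\<beta> - 1 \<le> \<beta>'" "\<beta>' \<le> \<beta>" "\<gamma> - 1 \<le> \<gamma>'" "\<gamma>' \<le> \<gamma>" for \<alpha>' \<beta>' \<gamma>'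
        by (rule step.IH) (use that 3 in auto)
      ultimately show ?thesis
        by (simp only: row_det_Suc) (simp add: P_def IH)
    qed
    finally show ?thesis .
  qed
qed

subsection \<open>The event in terms of the multiline queue\<close>

definition middle_event :: "triple \<Rightarrow> bool" where
  "middle_event = (\<lambda>(X, Y, Z). 1 \<in> Z \<and> 1 \<notin> Y \<and> 2 \<notin> Z \<and> 3 \<in> Z \<and> 3 \<notin> X)"

lemma ring_queue_first_sites:
  assumes q: "ring_queue n A S q" and n: "3 \<le> n"
  shows "q 1 = q n + of_bool (1 \<in> A) - of_bool (1 \<in> S)"
    and "q 2 = q 1 + of_bool (2 \<in> A) - of_bool (2 \<in> S)"
    and "1 \<in> departures n A S \<longleftrightarrow> 1 \<in> S \<and> (0 < q n \<or> 1 \<in> A)"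
    and "2 \<in> departures n A S \<longleftrightarrow> 2 \<in> S \<and> (0 < q 1 \<or> 2 \<in> A)"
    and "3 \<in> departures n A S \<longleftrightarrow> 3 \<in> S \<and> (0 < q 2 \<or> 3 \<in> A)"
proof -
  have rec: "\<And>t. t \<in> {1..n} \<Longrightarrow> q t = q (left_site n t) + of_bool (t \<in> A) - of_bool (t \<in> S)"
    using q by (simp add: ring_queue_def)
  show "q 1 = q n + of_bool (1 \<in> A) - of_bool (1 \<in> S)"
    "q 2 = q 1 + of_bool (2 \<in> A) - of_bool (2 \<in> S)"
    using rec[of 1] rec[of 2] n by (simp_all add: left_site_def)
  show "1 \<in> departures n A S \<longleftrightarrow> 1 \<in> S \<and> (0 < q n \<or> 1 \<in> A)"
    "2 \<in> departures n A S \<longleftrightarrow> 2 \<in> S \<and> (0 < q 1 \<or> 2 \<in> A)"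
    "3 \<in> departures n A S \<longleftrightarrow> 3 \<in> S \<and> (0 < q 2 \<or> 3 \<in> A)"
    unfolding departures_eq[OF q] using n by (auto simp: left_site_def)
qed

lemma middle_event_mlq:
  assumes r: "(x1, x2, x3) \<in> triples n a b c" and n: "3 \<le> n" and le: "a \<le> b" "b \<le> c"
  shows "middle_event (mlq_output n (x1, x2, x3)) \<longleftrightarrow>
    1 \<in> x3 \<and> 2 \<notin> x3 \<and> 3 \<in> x3 \<and> 1 \<notin> x2 \<and> dominated 0 n x2 x3 \<and>
    (2 \<in> x2 \<or> 3 \<in> x2 \<longrightarrow>
      dominated 0 n x1 x2 \<and> 1 \<notin> x1 \<and> 2 \<notin> x1 \<and> (3 \<in> x2 \<longrightarrow> 3 \<notin> x1))"
proof -
  have sub: "x1 \<subseteq> {1..n}" "x2 \<subseteq> {1..n}" "x3 \<subseteq> {1..n}" using r by (auto simp: triples_def)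
  define W where "W = departures n x1 x2"
  have n1: "1 \<le> n" "0 < n" using n by auto
  obtain q1 q2 q3 where q: "ring_queue n x1 x2 q1" "ring_queue n x2 x3 q2" "ring_queue n W x3 q3"
    using triples_queues[OF r n1(2) le] unfolding W_def by blast
  have W: "W \<subseteq> x2" unfolding W_def by (rule departures_subset)
  have dom: "q1 n = 0 \<longleftrightarrow> dominated 0 n x1 x2" "q2 n = 0 \<longleftrightarrow> dominated 0 n x2 x3"
    using queue_empty_iff_dominated[OF q(1) n1(1)] queue_empty_iff_dominated[OF q(2) n1(1)] sub by auto
  note s1 = ring_queue_first_sites[OF q(1) n, folded W_def]
  note s2 = ring_queue_first_sites[OF q(2) n]
  note s3 = ring_queue_first_sites[OF q(3) n]
  have q32: "q3 n \<le> q2 n" using ring_queue_mono[OF q(3,2) W] n by simp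
  have "3 \<notin> departures n W x3 \<longleftrightarrow> 2 \<notin> W \<and> 3 \<notin> W"
    if "1 \<in> x3" "2 \<notin> x3" "3 \<in> x3" "1 \<notin> x2" "q2 n = 0"
  proof -
    have "1 \<notin> W" using W that by auto
    then have "q3 1 = 0" using s3(1) q32 that by simp
    then have "q3 2 = of_bool (2 \<in> W)" using s3(2) that by simp
    then show ?thesis using s3(5) that by simp
  qed
  moreover have "2 \<notin> W \<and> 3 \<notin> W \<longleftrightarrow>
    (2 \<in> x2 \<or> 3 \<in> x2 \<longrightarrow> q1 n = 0 \<and> 1 \<notin> x1 \<and> 2 \<notin> x1 \<and> (3 \<in> x2 \<longrightarrow> 3 \<notin> x1))" if "1 \<notin> x2"
  proof -
    have q11: "q1 1 = q1 n + of_bool (1 \<in> x1)" using s1(1) that by simp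
    then show ?thesis unfolding s1(4,5) s1(2) q11 by (cases "2 \<in> x2"; cases "3 \<in> x2") auto
  qed
  moreover have "middle_event (mlq_output n (x1, x2, x3)) \<longleftrightarrow>
    1 \<in> x3 \<and> 1 \<notin> departures n x2 x3 \<and> 2 \<notin> x3 \<and> 3 \<in> x3 \<and> 3 \<notin> departures n W x3"
    by (simp add: middle_event_def W_def)
  ultimately show ?thesis unfolding dom[symmetric] using s2(3) by auto
qed

text \<open>The tails starting at sites up to 3 are expressed by full sizes and the contents of the
  first sites, so that strict inequalities between sizes can settle them.\<close>

lemma dominated_first_sites:
  assumes x: "x \<subseteq> {1..n}" and y: "y \<subseteq> {1..n}" and n: "3 \<le> n"
  shows "dominated 0 n x y \<longleftrightarrow> dominated 4 n x y \<and> card x \<le> card y \<and>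
      card x + of_bool (1 \<in> y) \<le> card y + of_bool (1 \<in> x) \<and>
      card x + of_bool (1 \<in> y) + of_bool (2 \<in> y) \<le> card y + of_bool (1 \<in> x) + of_bool (2 \<in> x)"
    and "dominated 0 n x y \<Longrightarrow>
      card x + of_bool (1 \<in> y) + of_bool (2 \<in> y) + of_bool (3 \<in> y)
        \<le> card y + of_bool (1 \<in> x) + of_bool (2 \<in> x) + of_bool (3 \<in> x)"
proof -
  have tails: "card z = card (z \<inter> {0..n})"
    "card z = card (z \<inter> {1..n})"
    "card z = of_bool (1 \<in> z) + card (z \<inter> {2..n})"
    "card z = of_bool (1 \<in> z) + of_bool (2 \<in> z) + card (z \<inter> {3..n})"
    "card z = of_bool (1 \<in> z) + of_bool (2 \<in> z) + of_bool (3 \<in> z) + card (z \<inter> {4..n})"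
    if "z \<subseteq> {1..n}" for z
  proof -
    have "z \<inter> {0..n} = z" "z \<inter> {1..n} = z" using that by auto
    moreover have "card (z \<inter> {1..n}) = of_bool (1 \<in> z) + card (z \<inter> {2..n})"
      "card (z \<inter> {2..n}) = of_bool (2 \<in> z) + card (z \<inter> {3..n})"
      "card (z \<inter> {3..n}) = of_bool (3 \<in> z) + card (z \<inter> {4..n})"
      using card_Int_atLeastAtMost_Suc[of 1 n z] card_Int_atLeastAtMost_Suc[of 2 n z]
        card_Int_atLeastAtMost_Suc[of 3 n z] n
      by (simp_all add: numeral_eq_Suc)
    ultimately show "card z = card (z \<inter> {0..n})"
      "card z = card (z \<inter> {1..n})"
      "card z = of_bool (1 \<in> z) + card (z \<inter> {2..n})"
      "card z = of_bool (1 \<in> z) + of_bool (2 \<in> z) + card (z \<inter> {3..n})"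
      "card z = of_bool (1 \<in> z) + of_bool (2 \<in> z) + of_bool (3 \<in> z) + card (z \<inter> {4..n})"
      by simp_all
  qed
  have split: "(\<forall>u\<ge>0. P u) \<longleftrightarrow> P 0 \<and> P 1 \<and> P 2 \<and> P 3 \<and> (\<forall>u\<ge>4. P u)" for P :: "nat \<Rightarrow> bool"
  proof -
    have "u = 0 \<or> u = 1 \<or> u = 2 \<or> u = 3 \<or> 4 \<le> u" for u :: nat by arith
    then show ?thesis by (metis zero_le)
  qed
  show "dominated 0 n x y \<longleftrightarrow> dominated 4 n x y \<and> card x \<le> card y \<and>
      card x + of_bool (1 \<in> y) \<le> card y + of_bool (1 \<in> x) \<and>
      card x + of_bool (1 \<in> y) + of_bool (2 \<in> y) \<le> card y + of_bool (1 \<in> x) + of_bool (2 \<in> x)"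
  proof -
    have "card (x \<inter> {0..n}) \<le> card (y \<inter> {0..n}) \<longleftrightarrow> card x \<le> card y"
      using tails(1)[OF x] tails(1)[OF y] by simp
    moreover have "card (x \<inter> {1..n}) \<le> card (y \<inter> {1..n}) \<longleftrightarrow> card x \<le> card y"
      using tails(2)[OF x] tails(2)[OF y] by simp
    moreover have "card (x \<inter> {2..n}) \<le> card (y \<inter> {2..n}) \<longleftrightarrow>
        card x + of_bool (1 \<in> y) \<le> card y + of_bool (1 \<in> x)"
      using tails(3)[OF x] tails(3)[OF y] by simp
    moreover have "card (x \<inter> {3..n}) \<le> card (y \<inter> {3..n}) \<longleftrightarrow>
        card x + of_bool (1 \<in> y) + of_bool (2 \<in> y) \<le> card y + of_bool (1 \<in> x) + of_bool (2 \<in> x)"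
      using tails(4)[OF x] tails(4)[OF y] by simp
    ultimately show ?thesis unfolding dominated_def split by argo
  qed
  assume "dominated 0 n x y"
  then have "card (x \<inter> {4..n}) \<le> card (y \<inter> {4..n})" by (simp add: dominated_def)
  then show "card x + of_bool (1 \<in> y) + of_bool (2 \<in> y) + of_bool (3 \<in> y)
        \<le> card y + of_bool (1 \<in> x) + of_bool (2 \<in> x) + of_bool (3 \<in> x)"
    using tails(5)[OF x] tails(5)[OF y] by linarith
qed

lemma Int_lessThan_4_iff:
  fixes p :: "nat set"
  assumes "p \<subseteq> {1, 2, 3}"
  shows "x \<subseteq> {..n} \<and> x \<inter> {..<4} = p \<longleftrightarrow>
    x \<subseteq> {1..n} \<and> (1 \<in> x \<longleftrightarrow> 1 \<in> p) \<and> (2 \<in> x \<longleftrightarrow> 2 \<in> p) \<and> (3 \<in> x \<longleftrightarrow> 3 \<in> p)" (is "?l \<longleftrightarrow> ?r")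
proof
  assume l: ?l
  have "0 \<notin> p" using assms by auto
  then have "0 \<notin> x" using l by fastforce
  then have "x \<subseteq> {1..n}" using l by (metis One_nat_def Suc_leI atLeastAtMost_iff atMost_iff gr0I subset_iff)
  then show ?r using l by fastforce
next
  assume r: ?r
  have "v \<in> x \<inter> {..<4} \<longleftrightarrow> v \<in> p" for v
  proof -
    consider "v = 0" | "v = 1" | "v = 2" | "v = 3" | "4 \<le> v" by linarith
    then show ?thesis using r assms by cases auto
  qed
  then show ?l using r by fastforce
qed

lemma pattern_rows_4_iff:
  assumes "p1 \<subseteq> {1, 2, 3}" "p2 \<subseteq> {1, 2, 3}" "p3 \<subseteq> {1, 2, 3}"
  shows "(x1, x2, x3) \<in> pattern_rows n 4 p1 p2 p3 (int a) (int b) (int c) \<longleftrightarrow>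
    (x1, x2, x3) \<in> triples n a b c \<and>
    ((1 \<in> x1 \<longleftrightarrow> 1 \<in> p1) \<and> (2 \<in> x1 \<longleftrightarrow> 2 \<in> p1) \<and> (3 \<in> x1 \<longleftrightarrow> 3 \<in> p1)) \<and>
    ((1 \<in> x2 \<longleftrightarrow> 1 \<in> p2) \<and> (2 \<in> x2 \<longleftrightarrow> 2 \<in> p2) \<and> (3 \<in> x2 \<longleftrightarrow> 3 \<in> p2)) \<and>
    ((1 \<in> x3 \<longleftrightarrow> 1 \<in> p3) \<and> (2 \<in> x3 \<longleftrightarrow> 2 \<in> p3) \<and> (3 \<in> x3 \<longleftrightarrow> 3 \<in> p3)) \<and>
    dominated 4 n x1 x2 \<and> dominated 4 n x2 x3"
  unfolding pattern_rows_def triples_def mem_Collect_eq prod.case mem_Times_iff fst_conv snd_conv of_nat_eq_iff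
  using Int_lessThan_4_iff[OF assms(1), of x1 n] Int_lessThan_4_iff[OF assms(2), of x2 n]
    Int_lessThan_4_iff[OF assms(3), of x3 n] by argo

text \<open>Lower rows for which the top row is arbitrary. Their number is never computed: after
  normalisation it is free of \<open>a\<close> and cancels in the difference in
  \<open>a\<close>.\<close>

definition middle_pairs :: "nat \<Rightarrow> nat \<Rightarrow> nat \<Rightarrow> (nat set \<times> nat set) set" where
  "middle_pairs n b c = {(y, z). y \<subseteq> {1..n} \<and> card y = b \<and> z \<subseteq> {1..n} \<and> card z = c \<and>
     1 \<in> z \<and> 2 \<notin> z \<and> 3 \<in> z \<and> 1 \<notin> y \<and> 2 \<notin> y \<and> 3 \<notin> y \<and> dominated 0 n y z}"

text \<open>The determinants come from the contents \<open>({}, {3})\<close>,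
  \<open>({}, {2})\<close>, \<open>({3}, {2})\<close> and \<open>({}, {2, 3})\<close> of the first
  two rows on sites 1 to 3, with \<open>{1, 3}\<close> in the third row. The first two have equal
  sizes, hence the factor 2.\<close>

lemma card_middle_event:
  assumes n: "3 \<le> n" and le: "a \<le> b" "b \<le> c"
  shows "int (card {r \<in> triples n a b c. middle_event (mlq_output n r)}) =
    int (n choose a) * int (card (middle_pairs n b c)) +
    (if a < b \<and> b < c
     then 2 * row_det (n - 3) (int a) (int b - 1) (int c - 2)
       + row_det (n - 3) (int a - 1) (int b - 1) (int c - 2)
       + row_det (n - 3) (int a) (int b - 2) (int c - 2)
     else 0)"
proof -
  define E where "E = {r \<in> triples n a b c. middle_event (mlq_output n r)}"
  define U where "U = {x1. x1 \<subseteq> {1..n} \<and> card x1 = a} \<times> middle_pairs n b c"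
  define W where "W = {(x1, x2, x3) \<in> E. 2 \<in> x2 \<or> 3 \<in> x2}"
  have E: "(x1, x2, x3) \<in> E \<longleftrightarrow> (x1, x2, x3) \<in> triples n a b c \<and>
    1 \<in> x3 \<and> 2 \<notin> x3 \<and> 3 \<in> x3 \<and> 1 \<notin> x2 \<and> dominated 0 n x2 x3 \<and>
    (2 \<in> x2 \<or> 3 \<in> x2 \<longrightarrow>
      dominated 0 n x1 x2 \<and> 1 \<notin> x1 \<and> 2 \<notin> x1 \<and> (3 \<in> x2 \<longrightarrow> 3 \<notin> x1))" for x1 x2 x3
    unfolding E_def using middle_event_mlq[OF _ n le] by blast
  have in_triples: "x1 \<subseteq> {1..n}" "card x1 = a" "x2 \<subseteq> {1..n}" "card x2 = b" "x3 \<subseteq> {1..n}" "card x3 = c"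
    if "(x1, x2, x3) \<in> triples n a b c" for x1 x2 x3
    using that by (auto simp: triples_def)
  have fin: "finite E" unfolding E_def using finite_triples by simp
  have "r \<in> E \<longleftrightarrow> r \<in> U \<union> W" for r
  proof -
    obtain x1 x2 x3 where r: "r = (x1, x2, x3)" by (metis surj_pair)
    show ?thesis
    proof (cases "2 \<in> x2 \<or> 3 \<in> x2")
      case True
      then show ?thesis by (auto simp: r U_def W_def middle_pairs_def)
    next
      case False
      then have "r \<in> E \<longleftrightarrow> (x1, x2, x3) \<in> triples n a b c \<and>
        1 \<in> x3 \<and> 2 \<notin> x3 \<and> 3 \<in> x3 \<and> 1 \<notin> x2 \<and> dominated 0 n x2 x3" by (simp add: r E)
      also have "\<dots> \<longleftrightarrow> r \<in> U"
        using False by (auto simp: r U_def middle_pairs_def triples_def)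
      finally show ?thesis using False by (auto simp: r W_def)
    qed
  qed
  then have EUW: "E = U \<union> W" by blast
  have disj: "U \<inter> W = {}" by (auto simp: U_def W_def middle_pairs_def)
  have cardU: "card U = (n choose a) * card (middle_pairs n b c)"
    by (simp add: U_def card_cartesian_product n_subsets)
  have card_E: "card E = card U + card W"
    unfolding EUW using disj fin[unfolded EUW] by (intro card_Un_disjoint) auto
  \<comment> \<open>Before some dominated tail the lower row has more elements than the upper one,
    so the sizes differ strictly.\<close>
  have strict: "a < b \<and> b < c" if W_ne: "W \<noteq> {}"
  proof -
    obtain r where "r \<in> W" using W_ne by blast
    then obtain x1 x2 x3 where w: "(x1, x2, x3) \<in> E" "2 \<in> x2 \<or> 3 \<in> x2"
      by (cases r) (auto simp: W_def)
    then have t: "(x1, x2, x3) \<in> triples n a b c" by (simp add: E)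
    note sub = in_triples[OF t]
    have "dominated 0 n x1 x2" "dominated 0 n x2 x3" "1 \<notin> x1" "2 \<notin> x1" "1 \<notin> x2" "3 \<in> x2 \<longrightarrow> 3 \<notin> x1"
      "1 \<in> x3"
      using w E by auto
    then show ?thesis
      using dominated_first_sites[OF sub(1,3) n] dominated_first_sites[OF sub(3,5) n] w(2) sub(2,4,6)
      by (auto split: if_splits simp: of_bool_def)
  qed
  show ?thesis
  proof (cases "a < b \<and> b < c")
    case False
    then have "W = {}" using strict by blast
    then show ?thesis using card_E cardU unfolding E_def if_not_P[OF False] by simp
  next
    case True
    define P where "P p1 p2 = pattern_rows n 4 p1 p2 {1, 3} (int a) (int b) (int c)" for p1 p2
    have finP: "finite (P p1 p2)" for p1 p2 by (simp add: P_def finite_pattern_rows)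
    have P: "(x1, x2, x3) \<in> P p1 p2 \<longleftrightarrow> (x1, x2, x3) \<in> triples n a b c \<and>
      ((1 \<in> x1 \<longleftrightarrow> 1 \<in> p1) \<and> (2 \<in> x1 \<longleftrightarrow> 2 \<in> p1) \<and> (3 \<in> x1 \<longleftrightarrow> 3 \<in> p1)) \<and>
      ((1 \<in> x2 \<longleftrightarrow> 1 \<in> p2) \<and> (2 \<in> x2 \<longleftrightarrow> 2 \<in> p2) \<and> (3 \<in> x2 \<longleftrightarrow> 3 \<in> p2)) \<and>
      (1 \<in> x3 \<and> 2 \<notin> x3 \<and> 3 \<in> x3) \<and> dominated 4 n x1 x2 \<and> dominated 4 n x2 x3"
      if "p1 \<subseteq> {1, 2, 3}" "p2 \<subseteq> {1, 2, 3}" for x1 x2 x3 p1 p2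
      unfolding P_def using pattern_rows_4_iff[OF that, of "{1, 3}" x1 x2 x3 n a b c] by simp
    have W_iff: "r \<in> W \<longleftrightarrow> r \<in> P {} {3} \<or> r \<in> P {} {2} \<or> r \<in> P {3} {2} \<or> r \<in> P {} {2, 3}" for r
    proof -
      obtain x1 x2 x3 where r: "r = (x1, x2, x3)" by (metis surj_pair)
      show ?thesis
      proof (cases "(x1, x2, x3) \<in> triples n a b c \<and> 1 \<in> x3 \<and> 2 \<notin> x3 \<and> 3 \<in> x3 \<and> 1 \<notin> x2 \<and> 1 \<notin> x1 \<and> 2 \<notin> x1")
        case False
        then show ?thesis by (auto simp: r P W_def E)
      next
        case c: True
        then have t: "(x1, x2, x3) \<in> triples n a b c" by simp
        note sub = in_triples[OF t]
        \<comment> \<open>Strictly increasing sizes leave room for the surplus of the lower row at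
          the first sites.\<close>
        have "dominated 0 n x1 x2 \<longleftrightarrow> dominated 4 n x1 x2"
          using dominated_first_sites(1)[OF sub(1,3) n] True c sub by (auto simp: of_bool_def)
        moreover have "dominated 0 n x2 x3 \<longleftrightarrow> dominated 4 n x2 x3"
          using dominated_first_sites(1)[OF sub(3,5) n] True c sub by (auto simp: of_bool_def)
        ultimately show ?thesis
          using c by (cases "2 \<in> x2"; cases "3 \<in> x2"; cases "3 \<in> x1") (auto simp: r P W_def E)
      qed
    qed
    then have W_eq: "W = P {} {3} \<union> (P {} {2} \<union> (P {3} {2} \<union> P {} {2, 3}))" by blast
    have disjP: "P p1 p2 \<inter> P p1' p2' = {}" if "p1 \<noteq> p1' \<or> p2 \<noteq> p2'" for p1 p2 p1' p2'
    proof (rule equals0I)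
      fix r assume "r \<in> P p1 p2 \<inter> P p1' p2'"
      then show False
        using that unfolding P_def by (cases r) (auto dest!: pattern_rows_pattern)
    qed
    have neq: "{3} \<noteq> {2::nat}" "{3} \<noteq> {2, 3::nat}" "{2} \<noteq> {2, 3::nat}" by auto
    have "P {} {3} \<inter> (P {} {2} \<union> (P {3} {2} \<union> P {} {2, 3})) = {}"
      "P {} {2} \<inter> (P {3} {2} \<union> P {} {2, 3}) = {}" "P {3} {2} \<inter> P {} {2, 3} = {}"
      unfolding Int_Un_distrib Un_empty by (intro conjI disjP; use neq in simp)+
    then have "card W = card (P {} {3}) + (card (P {} {2}) + (card (P {3} {2}) + card (P {} {2, 3})))"
      unfolding W_eq using finP by (simp add: card_Un_disjoint)
    moreover have "int (card (P p1 p2)) =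
        row_det (n - 3) (int a - int (card p1)) (int b - int (card p2)) (int c - 2)"
      if "p1 \<subseteq> {3}" "p2 \<subseteq> {2, 3}" "p2 \<noteq> {}" for p1 p2
    proof -
      have "card {Suc 0, 3} = 2" by simp
      then have "int (card (P p1 p2)) = int (card (pattern_rows n 4 {} {} {}
          (int a - int (card p1)) (int b - int (card p2)) (int c - 2)))"
        unfolding P_def using that n by (subst card_pattern_rows) auto
      also have "\<dots> = row_det (Suc n - 4) (int a - int (card p1)) (int b - int (card p2)) (int c - 2)"
      proof (rule card_dominated_rows)
        have "card p2 \<le> card {2, 3::nat}" by (rule card_mono) (use that in auto)
        moreover have "0 < card p2" using that by (metis card_gt_0_iff finite.simps finite_subset)
        ultimately show "int a - int (card p1) \<le> int b - int (card p2) + 1"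
          "int b - int (card p2) \<le> int c - 2 + 1" using True by auto
      qed (use n in simp)
      finally show ?thesis by simp
    qed
    ultimately have "int (card W) = 2 * row_det (n - 3) (int a) (int b - 1) (int c - 2)
       + row_det (n - 3) (int a - 1) (int b - 1) (int c - 2)
       + row_det (n - 3) (int a) (int b - 2) (int c - 2)"
      by simp
    then show ?thesis using card_E cardU True unfolding E_def by simp
  qed
qed

subsection \<open>Evaluation\<close>

lemma ibinomial_absorb:
  "int (Suc m) * ibinomial m (k - 1) = k * ibinomial (Suc m) k"
  "int (Suc m) * ibinomial m k = (int (Suc m) - k) * ibinomial (Suc m) k"
proof -
  show 1: "int (Suc m) * ibinomial m (k - 1) = k * ibinomial (Suc m) k" for k
  proof (cases "k \<le> 0")
    case False
    then obtain l where k: "k = int (Suc l)" by (metis not_le pos_int_cases Suc_pred)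
    have "int (Suc m * (m choose l)) = int (Suc l * (Suc m choose Suc l))"
      by (simp only: Suc_times_binomial_eq mult.commute)
    then show ?thesis by (simp add: k ibinomial_def nat_add_distrib algebra_simps del: binomial_Suc_Suc)
  qed (auto simp: ibinomial_def)
  show "int (Suc m) * ibinomial m k = (int (Suc m) - k) * ibinomial (Suc m) k"
    using 1[of k] by (simp add: ibinomial_Suc algebra_simps)
qed

text \<open>\<open>weight n r x\<close> is \<open>n (n - 1) (n - 2)\<close> times the probability that a uniform random set of
  \<open>x\<close> among \<open>n\<close> sites meets three given sites in a given set of size \<open>r\<close>.\<close>

definition weight :: "real \<Rightarrow> nat \<Rightarrow> real \<Rightarrow> real" where
  "weight n r x = (\<Prod>l<r. x - real l) * (\<Prod>l<3 - r. n - x - real l)"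

lemma weight_simps:
  "weight n 0 x = (n - x) * (n - x - 1) * (n - x - 2)"
  "weight n (Suc 0) x = x * (n - x) * (n - x - 1)"
  "weight n 2 x = x * (x - 1) * (n - x)"
  "weight n 3 x = x * (x - 1) * (x - 2)"
  by (simp_all add: weight_def eval_nat_numeral lessThan_Suc)

text \<open>Three absorption steps raise the upper index from \<open>n - 3\<close> to
  \<open>n\<close>; each contributes one factor, for an occupied or for an empty site.\<close>

lemma ibinomial_weight:
  assumes n: "3 \<le> n"
  defines "M \<equiv> real n * (real n - 1) * (real n - 2)"
  shows "M * real_of_int (ibinomial (n - 3) (int x)) = real (n choose x) * weight n 0 x"
    and "M * real_of_int (ibinomial (n - 3) (int x - 1)) = real (n choose x) * weight n 1 x"
    and "M * real_of_int (ibinomial (n - 3) (int x - 2)) = real (n choose x) * weight n 2 x"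
    and "M * real_of_int (ibinomial (n - 3) (int x - 3)) = real (n choose x) * weight n 3 x"
proof -
  define m where "m = n - 3"
  have n: "n = Suc (Suc (Suc m))" using n by (simp add: m_def)
  define f where "f m k = real_of_int (ibinomial m k)" for m k
  have absorb: "real (Suc m) * f m (k - 1) = real_of_int k * f (Suc m) k"
    "real (Suc m) * f m k = (real (Suc m) - real_of_int k) * f (Suc m) k" for m k
    using ibinomial_absorb[of m k, THEN arg_cong[of _ _ real_of_int]] by (simp_all add: f_def)
  have absorb': "real (Suc m) * f m (k - 2) = real_of_int (k - 1) * f (Suc m) (k - 1)"
    "real (Suc m) * f m (k - 3) = real_of_int (k - 2) * f (Suc m) (k - 2)" for m k
    using absorb(1)[of m "k - 1"] absorb(1)[of m "k - 2"] by simp_all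
  have top: "f (Suc (Suc (Suc m))) (int x) = real (n choose x)" by (simp add: f_def ibinomial_def n)
  have real: "real (Suc m) = real n - 2" "real (Suc (Suc m)) = real n - 1" "real (Suc (Suc (Suc m))) = real n"
    by (simp_all add: n)
  have three: "(p2 * p1 * p0) * f0 = f3 * (c0 * c1 * c2)"
    if "p0 * f0 = c0 * f1" "p1 * f1 = c1 * f2" "p2 * f2 = c2 * f3"
    for p0 p1 p2 c0 c1 c2 f0 f1 f2 f3 :: real
    using that by algebra
  note eqs = top real of_int_diff of_int_of_nat_eq of_int_1 of_int_numeral
  note folds = M_def weight_simps One_nat_def m_def[symmetric] f_def[symmetric]
  show "M * real_of_int (ibinomial (n - 3) (int x)) = real (n choose x) * weight n 0 x"
    using three[OF absorb(2)[of m "int x"] absorb(2)[of "Suc m" "int x"] absorb(2)[of "Suc (Suc m)" "int x"]]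
    unfolding folds eqs by algebra
  show "M * real_of_int (ibinomial (n - 3) (int x - 1)) = real (n choose x) * weight n 1 x"
    using three[OF absorb(1)[of m "int x"] absorb(2)[of "Suc m" "int x"] absorb(2)[of "Suc (Suc m)" "int x"]]
    unfolding folds eqs by algebra
  show "M * real_of_int (ibinomial (n - 3) (int x - 2)) = real (n choose x) * weight n 2 x"
    using three[OF absorb'(1)[of m "int x"] absorb(1)[of "Suc m" "int x"] absorb(2)[of "Suc (Suc m)" "int x"]]
    unfolding folds eqs by algebra
  show "M * real_of_int (ibinomial (n - 3) (int x - 3)) = real (n choose x) * weight n 3 x"
    using three[OF absorb'(2)[of m "int x"] absorb'(1)[of "Suc m" "int x"]
        absorb(1)[of "Suc (Suc m)" "int x"]]
    unfolding folds eqs by algebra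
qed

text \<open>The three determinants with free entries; the digit says by how much the lower index of
  the binomial is reduced. Free entries expose the linearity in each block, through which scaling
  and differences pass.\<close>

definition middle_sum ::
  "real \<Rightarrow> real \<Rightarrow> real \<Rightarrow> real \<Rightarrow> real \<Rightarrow> real \<Rightarrow> real \<Rightarrow> real \<Rightarrow> real \<Rightarrow> real \<Rightarrow> real \<Rightarrow> real" where
  "middle_sum a0 a1 a2 a3 b0 b1 b2 b3 c0 c1 c2 =
     2 * det3 c2 c1 c0 b2 b1 b0 a2 a1 a0 + det3 c2 c1 c0 b2 b1 b0 a3 a2 a1
       + det3 c2 c1 c0 b3 b2 b1 a2 a1 a0"

lemma middle_sum_scale:
  "middle_sum (a * a0) (a * a1) (a * a2) (a * a3) (b * b0) (b * b1) (b * b2) (b * b3)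
     (c * c0) (c * c1) (c * c2) = (a * b * c) * middle_sum a0 a1 a2 a3 b0 b1 b2 b3 c0 c1 c2"
  by (simp add: middle_sum_def det3_def algebra_simps)

lemma middle_sum_diff:
  "middle_sum (a0 - a0') (a1 - a1') (a2 - a2') (a3 - a3') b0 b1 b2 b3 c0 c1 c2 =
     middle_sum a0 a1 a2 a3 b0 b1 b2 b3 c0 c1 c2 - middle_sum a0' a1' a2' a3' b0 b1 b2 b3 c0 c1 c2"
  "middle_sum a0 a1 a2 a3 (b0 - b0') (b1 - b1') (b2 - b2') (b3 - b3') c0 c1 c2 =
     middle_sum a0 a1 a2 a3 b0 b1 b2 b3 c0 c1 c2 - middle_sum a0 a1 a2 a3 b0' b1' b2' b3' c0 c1 c2"
  "middle_sum a0 a1 a2 a3 b0 b1 b2 b3 (c0 - c0') (c1 - c1') (c2 - c2') =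
     middle_sum a0 a1 a2 a3 b0 b1 b2 b3 c0 c1 c2 - middle_sum a0 a1 a2 a3 b0 b1 b2 b3 c0' c1' c2'"
  by (simp_all add: middle_sum_def det3_def algebra_simps)

definition middle_weight :: "real \<Rightarrow> real \<Rightarrow> real \<Rightarrow> real \<Rightarrow> real" where
  "middle_weight n a b c = middle_sum
     (weight n 0 a) (weight n 1 a) (weight n 2 a) (weight n 3 a)
     (weight n 0 b) (weight n 1 b) (weight n 2 b) (weight n 3 b)
     (weight n 0 c) (weight n 1 c) (weight n 2 c)"

text \<open>For \<open>a = b\<close> the first determinant has two equal rows and the other two
  cancel. So the formula also covers this case, where no such rows exist.\<close>

lemma middle_weight_diagonal: "middle_weight n b b c = 0"
  by (simp add: middle_weight_def middle_sum_def det3_def algebra_simps)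

lemma row_det_weight:
  assumes n: "3 \<le> n"
  defines "M \<equiv> real n * (real n - 1) * (real n - 2)"
  shows "M ^ 3 * real_of_int (2 * row_det (n - 3) (int a) (int b - 1) (int c - 2)
       + row_det (n - 3) (int a - 1) (int b - 1) (int c - 2)
       + row_det (n - 3) (int a) (int b - 2) (int c - 2))
    = real (n choose a) * real (n choose b) * real (n choose c) * middle_weight n a b c"
proof -
  define f where "f k = real_of_int (ibinomial (n - 3) k)" for k
  note w = ibinomial_weight[OF n, folded M_def f_def]
  have "real_of_int (2 * row_det (n - 3) (int a) (int b - 1) (int c - 2)
       + row_det (n - 3) (int a - 1) (int b - 1) (int c - 2)
       + row_det (n - 3) (int a) (int b - 2) (int c - 2))
    = middle_sum (f a) (f (int a - 1)) (f (int a - 2)) (f (int a - 3))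
       (f b) (f (int b - 1)) (f (int b - 2)) (f (int b - 3)) (f c) (f (int c - 1)) (f (int c - 2))"
    by (simp add: row_det_def middle_sum_def det3_def f_def)
  also have "M ^ 3 * \<dots> = middle_sum (M * f a) (M * f (int a - 1)) (M * f (int a - 2)) (M * f (int a - 3))
       (M * f b) (M * f (int b - 1)) (M * f (int b - 2)) (M * f (int b - 3))
       (M * f c) (M * f (int c - 1)) (M * f (int c - 2))"
    by (simp only: middle_sum_scale power3_eq_cube)
  also have "\<dots> = real (n choose a) * real (n choose b) * real (n choose c) * middle_weight n a b c"
    by (simp only: w middle_sum_scale middle_weight_def)
  finally show ?thesis .
qed

lemma prob_middle:
  assumes n: "3 \<le> n" and st: "tasep_stationary n \<pi>" and le: "a \<le> b" "b \<le> c" "c \<le> n"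
  defines "M \<equiv> real n * (real n - 1) * (real n - 2)"
  shows "measure_pmf.prob \<pi> {w. b < w 1 \<and> w 1 \<le> c \<and> c < w 2 \<and> a < w 3 \<and> w 3 \<le> c} =
    real (card (middle_pairs n b c)) / (real (n choose b) * real (n choose c))
      + (if b < c then middle_weight n a b c / M ^ 3 else 0)"
proof -
  have "M \<noteq> 0" using n by (simp add: M_def)
  have pos: "0 < real (n choose a)" "0 < real (n choose b)" "0 < real (n choose c)"
    using le by (simp_all add: zero_less_binomial)
  have set_eq: "{w. b < w 1 \<and> w 1 \<le> c \<and> c < w 2 \<and> a < w 3 \<and> w 3 \<le> c} = {w. middle_event (threshold n a b c w)}"
    using n by (auto simp: middle_event_def threshold_def sites_below_def)
  define d where "d = (if b < c then middle_weight n a b c / M ^ 3 else 0)"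
  define N where "N = card {r \<in> triples n a b c. middle_event (mlq_output n r)}"
  have "real N = real_of_int (int N)" by simp
  also have "\<dots> = real (n choose a) * real (card (middle_pairs n b c))
      + real (n choose a) * real (n choose b) * real (n choose c) * d"
  proof (cases "a < b \<and> b < c")
    case True
    then show ?thesis
      using row_det_weight[OF n, of a b c, folded M_def] \<open>M \<noteq> 0\<close>
      unfolding N_def card_middle_event[OF n le(1,2)] d_def by (simp add: field_simps)
  next
    case False
    then have "d = 0" using le middle_weight_diagonal by (auto simp: d_def)
    then show ?thesis using False unfolding N_def card_middle_event[OF n le(1,2)] by auto
  qed
  finally show ?thesis
    unfolding set_eq prob_threshold_mlq[OF n st le] N_def[symmetric] d_def[symmetric]
    using pos by (simp add: field_simps)
qed

text \<open>For \<open>a, b \<le> c\<close> the indicator factorises over the sites. Differences in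
  \<open>a\<close> and \<open>b\<close> remove the terms with \<open>c < w 3\<close> and
  \<open>c < w 1\<close>, and a product of three point indicators remains.\<close>

lemma prob_inclusion_exclusion:
  assumes st: "tasep_stationary n \<pi>" and ijk: "1 \<le> i" "i < j" "j < k"
  defines "p \<equiv> \<lambda>a b c. measure_pmf.prob \<pi> {w. b < w 1 \<and> w 1 \<le> c \<and> c < w 2 \<and> a < w 3 \<and> w 3 \<le> c}"
  shows "measure_pmf.prob \<pi> {w. w 1 = j \<and> w 2 = k \<and> w 3 = i} =
    ((p (i - 1) (j - 1) (k - 1) - p i (j - 1) (k - 1)) - (p (i - 1) j (k - 1) - p i j (k - 1)))
    - ((p (i - 1) (j - 1) k - p i (j - 1) k) - (p (i - 1) j k - p i j k))"
proof -
  define g where "g = (\<lambda>a b c (w :: nat \<Rightarrow> nat).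
    of_bool (b < w 1 \<and> w 1 \<le> c \<and> c < w 2 \<and> a < w 3 \<and> w 3 \<le> c) :: real)"
  have g: "g a b c w = (of_bool (b < w 1) - of_bool (c < w 1)) * of_bool (c < w 2)
      * (of_bool (a < w 3) - of_bool (c < w 3))" if "a \<le> c" "b \<le> c" for a b c w
    using that by (auto simp: g_def)
  have diff: "of_bool (x - 1 < y) - of_bool (x < y) = (of_bool (y = x) :: real)" if "1 \<le> x" for x y :: nat
    using that by auto
  have point: "of_bool (w 1 = j \<and> w 2 = k \<and> w 3 = i) =
    ((g (i - 1) (j - 1) (k - 1) w - g i (j - 1) (k - 1) w) - (g (i - 1) j (k - 1) w - g i j (k - 1) w))
    - ((g (i - 1) (j - 1) k w - g i (j - 1) k w) - (g (i - 1) j k w - g i j k w))" for w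
  proof -
    have "of_bool (w 1 = j \<and> w 2 = k \<and> w 3 = i) =
      (of_bool (w 1 = j) * of_bool (w 2 = k) * of_bool (w 3 = i) :: real)" by simp
    also have "\<dots> = (of_bool (j - 1 < w 1) - of_bool (j < w 1)) * (of_bool (k - 1 < w 2) - of_bool (k < w 2))
        * (of_bool (i - 1 < w 3) - of_bool (i < w 3))"
      using ijk by (simp only: diff)
    also have "\<dots> =
      ((g (i - 1) (j - 1) (k - 1) w - g i (j - 1) (k - 1) w) - (g (i - 1) j (k - 1) w - g i j (k - 1) w))
      - ((g (i - 1) (j - 1) k w - g i (j - 1) k w) - (g (i - 1) j k w - g i j k w))"
    proof -
      have le: "i - 1 \<le> k - 1" "i \<le> k - 1" "j - 1 \<le> k - 1" "j \<le> k - 1" "i - 1 \<le> k" "i \<le> k" "j - 1 \<le> k" "j \<le> k"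
        using ijk by auto
      show ?thesis unfolding g[OF le(1,3)] g[OF le(2,3)] g[OF le(1,4)] g[OF le(2,4)]
          g[OF le(5,7)] g[OF le(6,7)] g[OF le(5,8)] g[OF le(6,8)]
        by (simp only: ring_distribs)
    qed
    finally show ?thesis .
  qed
  show ?thesis
    unfolding p_def measure_stationary[OF st] point g_def sum_subtractf[symmetric] left_diff_distrib[symmetric] ..
qed

lemma weight_diff:
  "weight n 0 (x - 1) - weight n 0 x = 3 * (n - x) * (n - x - 1)"
  "weight n 1 (x - 1) - weight n 1 x = (n - x) * (3 * x - n - 1)"
  "weight n 2 (x - 1) - weight n 2 x = (x - 1) * (3 * x - 2 * n - 2)"
  "weight n 3 (x - 1) - weight n 3 x = - 3 * (x - 1) * (x - 2)"
  unfolding weight_simps One_nat_def by algebra+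

text \<open>Linearity in each block moves the differences into the entries, which become
  quadratic.\<close>

lemma middle_weight_diff:
  "((middle_weight n (i - 1) (j - 1) (k - 1) - middle_weight n i (j - 1) (k - 1))
      - (middle_weight n (i - 1) j (k - 1) - middle_weight n i j (k - 1)))
    - ((middle_weight n (i - 1) (j - 1) k - middle_weight n i (j - 1) k)
      - (middle_weight n (i - 1) j k - middle_weight n i j k))
   = (n - 1) * (n - 2) ^ 2 * (3 * (j - i) * (2 * n - j - i - 1) * (n - 1)
      - 4 * (j - i) * (n - k) * (n - 2))" (is "?l = ?r")
proof -
  have "?l = middle_sum
      (weight n 0 (i - 1) - weight n 0 i) (weight n 1 (i - 1) - weight n 1 i)
      (weight n 2 (i - 1) - weight n 2 i) (weight n 3 (i - 1) - weight n 3 i)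
      (weight n 0 (j - 1) - weight n 0 j) (weight n 1 (j - 1) - weight n 1 j)
      (weight n 2 (j - 1) - weight n 2 j) (weight n 3 (j - 1) - weight n 3 j)
      (weight n 0 (k - 1) - weight n 0 k) (weight n 1 (k - 1) - weight n 1 k)
      (weight n 2 (k - 1) - weight n 2 k)"
    unfolding middle_weight_def middle_sum_diff ..
  also have "\<dots> = ?r"
    unfolding weight_diff middle_sum_def det3_def by algebra
  finally show ?thesis .
qed

text \<open>For \<open>k = j + 1\<close> the corner \<open>b = c = j\<close> has no determinant
  term, but the full third difference contains it with a minus sign; it is added back.\<close>

lemma middle_weight_diff_contact:
  "(n - 1) * (n - 2) ^ 2 * (3 * (j - i) * (2 * n - j - i - 1) * (n - 1)
      - 4 * (j - i) * (n - (j + 1)) * (n - 2))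
    + (middle_weight n (i - 1) j j - middle_weight n i j j)
   = (n - 1) * (n - 2) ^ 2 * ((j - i) * (n - 1 - j) *
        (n + 3 * (n - i - 1) * (n - 2) - (n - 1 - j) * (3 * n - 3 * i + j - 1))
      + 6 * (j - i) * (n - i) * (n - 1))"
proof -
  have "middle_weight n (i - 1) j j - middle_weight n i j j =
middle_sum
      (weight n 0 (i - 1) - weight n 0 i) (weight n 1 (i - 1) - weight n 1 i)
      (weight n 2 (i - 1) - weight n 2 i) (weight n 3 (i - 1) - weight n 3 i)
      (weight n 0 j) (weight n 1 j) (weight n 2 j) (weight n 3 j)
      (weight n 0 j) (weight n 1 j) (weight n 2 j)"
    unfolding middle_weight_def middle_sum_diff ..
  then show ?thesis
    unfolding weight_diff middle_sum_def det3_def weight_simps One_nat_def by algebra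
qed

text \<open>\<open>u\<close> and \<open>v\<close> stand for \<open>n - 1\<close> and
  \<open>n - 2\<close>, kept independent as only cancellation matters.\<close>

lemma generic_fraction:
  fixes n u v A B :: real
  assumes "n \<noteq> 0" "u \<noteq> 0" "v \<noteq> 0"
  shows "u * v ^ 2 * (A * u - B * v) / (n * u * v) ^ 3 = A / (n ^ 3 * u * v) - B / (n ^ 3 * u ^ 2)"
  using assms by (simp add: field_simps power2_eq_square power3_eq_cube)

lemma contact_fraction:
  fixes n u v A B s t :: real
  assumes "n \<noteq> 0" "u \<noteq> 0" "v \<noteq> 0"
  shows "u * v ^ 2 * (A * (n + s * v - t) + B * u) / (n * u * v) ^ 3 =
    A / (n ^ 2 * u ^ 2) * (1 / v + s / n - t / (n * v)) + B / (n ^ 3 * u * v)"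
  using assms by (simp add: field_simps power2_eq_square power3_eq_cube)

theorem theorem7p3:
  fixes n i j k :: nat and \<pi> :: "(nat \<Rightarrow> nat) pmf"
  assumes "n \<ge> 3"
    and "tasep_stationary n \<pi>"
    and "1 \<le> i" and "i < j" and "j < k" and "k \<le> n"
  defines "E \<equiv> measure_pmf.prob \<pi> {w. w 1 = j \<and> w 2 = k \<and> w 3 = i}"
  shows "(k > j + 1 \<longrightarrow>
           E = 3 * (real j - real i) * (2 * real n - real j - real i - 1)
                 / (real n ^ 3 * (real n - 1) * (real n - 2))
             - 4 * (real j - real i) * (real n - real k)
                 / (real n ^ 3 * (real n - 1) ^ 2)) \<and>
         (k = j + 1 \<longrightarrow>
           E = (real j - real i) * (real n - 1 - real j) / (real n ^ 2 * (real n - 1) ^ 2)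
                 * (1 / (real n - 2)
                    + 3 * (real n - real i - 1) / real n
                    - (real n - 1 - real j) * (3 * real n - 3 * real i + real j - 1)
                        / (real n * (real n - 2)))
             + 6 * (real j - real i) * (real n - real i)
                 / (real n ^ 3 * (real n - 1) * (real n - 2)))"
proof -
  define M where "M = real n * (real n - 1) * (real n - 2)"
  define p where "p = (\<lambda>a b c.
    measure_pmf.prob \<pi> {w. b < w 1 \<and> w 1 \<le> c \<and> c < w 2 \<and> a < w 3 \<and> w 3 \<le> c})"
  define m where "m a b c = (if b < c then middle_weight n a b c / M ^ 3 else 0)" for a b c :: real
  define D where "D = 3 * (real j - i) * (2 * real n - j - i - 1) * (real n - 1)
      - 4 * (real j - i) * (real n - k) * (real n - 2)"
  have nz: "real n \<noteq> 0" "real n - 1 \<noteq> 0" "real n - 2 \<noteq> 0" using assms(1) by auto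
  \<comment> \<open>Here the uncounted \<open>middle_pairs\<close> drop out.\<close>
  have pdiff: "p (i - 1) b c - p i b c = m (real i - 1) b c - m i b c"
    if "i \<le> b" "b \<le> c" "c \<le> n" for b c
    using prob_middle[OF assms(1,2), of "i - 1" b c] prob_middle[OF assms(1,2), of i b c] that \<open>1 \<le> i\<close>
    unfolding p_def m_def M_def[symmetric] by (simp add: of_nat_diff)
  have "E = ((p (i - 1) (j - 1) (k - 1) - p i (j - 1) (k - 1)) - (p (i - 1) j (k - 1) - p i j (k - 1)))
    - ((p (i - 1) (j - 1) k - p i (j - 1) k) - (p (i - 1) j k - p i j k))"
    unfolding E_def p_def using prob_inclusion_exclusion[OF assms(2-5)] .
  also have "\<dots> =
      ((m (real i - 1) (real j - 1) (real k - 1) - m i (real j - 1) (real k - 1))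
        - (m (real i - 1) j (real k - 1) - m i j (real k - 1)))
      - ((m (real i - 1) (real j - 1) k - m i (real j - 1) k)
        - (m (real i - 1) j k - m i j k))"
    using pdiff[of "j - 1" "k - 1"] pdiff[of j "k - 1"] pdiff[of "j - 1" k] pdiff[of j k] assms(3-6)
    by (simp add: of_nat_diff)
  finally have E: "E = \<dots>" .
  show ?thesis
  proof (intro conjI impI)
    assume k: "k > j + 1"
    \<comment> \<open>All four pairs \<open>(b, c)\<close> satisfy \<open>b < c\<close>.\<close>
    have "E = (real n - 1) * (real n - 2) ^ 2 * D / M ^ 3"
      unfolding E D_def middle_weight_diff[symmetric] using k by (simp add: m_def diff_divide_distrib)
    also have "\<dots> = 3 * (real j - real i) * (2 * real n - real j - real i - 1)
                 / (real n ^ 3 * (real n - 1) * (real n - 2))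
             - 4 * (real j - real i) * (real n - real k) / (real n ^ 3 * (real n - 1) ^ 2)"
      unfolding M_def D_def by (rule generic_fraction[OF nz])
    finally show "E = \<dots>" .
  next
    assume k: "k = j + 1"
    then have D: "D = 3 * (real j - i) * (2 * real n - j - i - 1) * (real n - 1)
      - 4 * (real j - i) * (real n - (real j + 1)) * (real n - 2)" by (simp add: D_def)
    \<comment> \<open>Of the four pairs \<open>(b, c)\<close> only \<open>(j, k - 1)\<close> has
      \<open>b = c\<close>.\<close>
    have "E = ((real n - 1) * (real n - 2) ^ 2 * D
        + (middle_weight n (real i - 1) j j - middle_weight n i j j)) / M ^ 3"
      unfolding E D_def middle_weight_diff[symmetric] using k
      by (simp add: m_def diff_divide_distrib add_divide_distrib)
    also have "\<dots> = (real n - 1) * (real n - 2) ^ 2 * ((real j - i) * (real n - 1 - j) *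
        (real n + 3 * (real n - i - 1) * (real n - 2) - (real n - 1 - j) * (3 * real n - 3 * real i + real j - 1))
      + 6 * (real j - i) * (real n - i) * (real n - 1)) / M ^ 3"
      unfolding D middle_weight_diff_contact ..
    also have "\<dots> = (real j - real i) * (real n - 1 - real j) / (real n ^ 2 * (real n - 1) ^ 2)
                 * (1 / (real n - 2)
                    + 3 * (real n - real i - 1) / real n
                    - (real n - 1 - real j) * (3 * real n - 3 * real i + real j - 1)
                        / (real n * (real n - 2)))
             + 6 * (real j - real i) * (real n - real i)
                 / (real n ^ 3 * (real n - 1) * (real n - 2))"
      unfolding M_def by (rule contact_fraction[OF nz])
    finally show "E = \<dots>" .
  qed
qed

end
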